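(* Let $K:SO(3)\times SO(3)\to\mathbb{R}$ be of the form $K(R,Q)=g(d(R,Q)^2)$ with $g:[0,\infty)\to\mathbb{R}$ differentiable with locally Lipschitz continuous derivative, and let $r<\pi/4-\varepsilon$. Suppose: (i) $g'\geq 0$ and $g'$ is continuously differentiable on $[0,4r^2]$; (ii) the function $h$ defined by $h(s)=\frac{s}{\sin s}g'(s^2)$ for $s\in(0,\pi)$ and $h(0)=g'(0)$ satisfies: for any $a>0$ there exists $0<b<a$ such that $h(b)>0$; and $h$ is non-decreasing; (iii) $\rho_0\in\mathcal{P}(\mathcal{D}_\varepsilon)$ satisfies $\mathrm{supp}(\rho_0)\subset\overline{D}_r$. Let $\rho\in\mathrm{C}([0,\infty);\mathcal{P}(\mathcal{D}_\varepsilon))$ be the global weak solution to the aggregation model $\partial_t\rho+\nabla\cdot(\rho v)=0$, $v=-\nabla K*\rho$, starting from $\rho_0$. Then there exists $P\in\overline{D}_r$ such that $W_1(\rho_t,\delta_P)\to 0$ as $t\to\infty$.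
   Context: $SO(3)$ is the group of $3\times3$ rotation matrices, with $T_RSO(3)=\{RA: A\in\mathbb{R}^{3\times3},\ A^T=-A\}$ and Riemannian metric $RA_1\cdot RA_2=\frac12\langle A_1,A_2\rangle_F$ ($\langle\cdot,\cdot\rangle_F$ is the Frobenius inner product). $d$ is the geodesic distance, $d(R,Q)=\arccos\big(\frac{\mathrm{tr}(R^TQ)-1}{2}\big)$, and $\nabla$ is the Riemannian gradient on $SO(3)$. For $r\in(0,\pi/2)$, $D_r=\{Q\in SO(3): d(I,Q)<r\}$ and $\overline{D}_r$ is its closure. $\varepsilon>0$ is fixed, arbitrarily small, and $\mathcal{D}_\varepsilon=D_{\frac{\pi}{2}-\varepsilon}$. $\mathcal{P}(\mathcal{D}_\varepsilon)$ is the set of Borel probability measures on $\mathcal{D}_\varepsilon$; $\mathrm{C}([0,\infty);\mathcal{P}(\mathcal{D}_\varepsilon))$ is the set of curves $[0,\infty)\to\mathcal{P}(\mathcal{D}_\varepsilon)$ that are continuous for the narrow topology. $W_1$ is the 1-Wasserstein distance for the cost $d$: $W_1(\rho,\sigma)=\inf_{\pi\in\Pi(\rho,\sigma)}\int d(R,Q)\,d\pi(R,Q)$, with $\Pi(\rho,\sigma)$ the set of couplings. $\delta_P$ is the Dirac mass at $P$. Write $K_Q(R)=K(R,Q)$. For a curve $\rho=(\rho_t)$ in $\mathcal{P}(\mathcal{D}_\varepsilon)$ the velocity field is $v[\rho](R,t)=-\int_{\mathcal{D}_\varepsilon}\nabla K_Q(R)\,d\rho_t(Q)$, $R\in\mathcal{D}_\varepsilon$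 (gradient in the variable $R$). Global weak solution: $(\rho_t)_{t\in[0,\infty)}\subset\mathcal{P}(\mathcal{D}_\varepsilon)$ is a global weak solution starting from $\rho_0$ if $v[\rho]$ generates a unique flow map $\Psi:\mathrm{supp}(\rho_0)\times[0,\infty)\to\mathcal{D}_\varepsilon$, i.e. $\frac{d}{dt}\Psi^t(R)=v[\rho](\Psi^t(R),t)$, $\Psi^0(R)=R$, and $\rho_t=\Psi^t\#\rho_0$ (push-forward) for all $t\ge0$. For $g'\ge0$ and $\mathrm{supp}(\rho_0)\subset\overline{D}_r$ with $r<\pi/2-\varepsilon$, such a solution exists, is unique, and satisfies $\mathrm{supp}(\rho_t)\subset\overline{D}_r$ for all $t\ge0$ (established elsewhere in the paper). *)

theory Defs
  imports "HOL-Probability.Probability"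
begin

type_synonym mat3 = "real^3^3"

definition SO3 :: "mat3 set" where
  "SO3 = {R. rotation_matrix R}"

definition tangent_SO3 :: "mat3 \<Rightarrow> mat3 set" where
  "tangent_SO3 R = {R ** A | A. transpose A = - A}"

text \<open>
  The metric at \<open>R\<close>: for \<open>X = R ** A\<close> in the tangent space, \<open>transpose R ** X = A\<close>, and \<open>\<bullet>\<close> on
  \<open>real^3^3\<close> is the Frobenius inner product.
\<close>

definition metric_SO3 :: "mat3 \<Rightarrow> mat3 \<Rightarrow> mat3 \<Rightarrow> real" where
  "metric_SO3 R X Y = 1/2 * ((transpose R ** X) \<bullet> (transpose R ** Y))"

definition geo_dist :: "mat3 \<Rightarrow> mat3 \<Rightarrow> real" where
  "geo_dist R Q = arccos ((trace (transpose R ** Q) - 1) / 2)"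

definition geo_ball :: "real \<Rightarrow> mat3 set" where
  "geo_ball r = {Q \<in> SO3. geo_dist (mat 1) Q < r}"

text \<open>
  The Riemannian gradient: the tangent vector representing the differential of \<open>f\<close> through the
  metric. A derivative within the embedded submanifold \<open>SO3\<close> depends only on the values of \<open>f\<close> on
  \<open>SO3\<close>, and it is determined (only) on tangent vectors, where it is the differential of \<open>f\<close>.
\<close>

definition grad_SO3 :: "(mat3 \<Rightarrow> real) \<Rightarrow> mat3 \<Rightarrow> mat3" where
  "grad_SO3 f R = (THE G. G \<in> tangent_SO3 R \<and>
     (\<exists>f'. (f has_derivative f') (at R within SO3) \<and>
           (\<forall>X\<in>tangent_SO3 R. f' X = metric_SO3 R G X)))"

definition prob_measures :: "'a::topological_space set \<Rightarrow> 'a measure set" where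
  "prob_measures S = {\<mu>. prob_space \<mu> \<and> sets \<mu> = sets (restrict_space borel S)}"

definition narrow_topology :: "'a::topological_space set \<Rightarrow> 'a measure topology" where
  "narrow_topology S = topology_generated_by
     {{\<mu> \<in> prob_measures S. (LINT x|\<mu>. \<phi> x) \<in> U} | (\<phi> :: 'a \<Rightarrow> real) U.
        continuous_on S \<phi> \<and> bounded (\<phi> ` S) \<and> open U}"

definition msupp :: "'a::topological_space measure \<Rightarrow> 'a set" where
  "msupp \<mu> = {x \<in> space \<mu>. \<forall>U. open U \<longrightarrow> x \<in> U \<longrightarrow> emeasure \<mu> (U \<inter> space \<mu>) > 0}"

definition couplings :: "'a measure \<Rightarrow> 'a measure \<Rightarrow> ('a \<times> 'a) measure set" where
  "couplings \<mu> \<nu> = {\<pi>. prob_space \<pi> \<and> sets \<pi> = sets (\<mu> \<Otimes>\<^sub>M \<nu>) \<and>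
                        distr \<pi> \<mu> fst = \<mu> \<and> distr \<pi> \<nu> snd = \<nu>}"

definition W1 :: "mat3 measure \<Rightarrow> mat3 measure \<Rightarrow> ennreal" where
  "W1 \<mu> \<nu> = (INF \<pi>\<in>couplings \<mu> \<nu>. \<integral>\<^sup>+ (R, Q). ennreal (geo_dist R Q) \<partial>\<pi>)"

text \<open>
  Each measure \<open>\<rho> t\<close> lives on its own domain \<open>space (\<rho> t)\<close>, so the integral is over that domain.
\<close>

definition velocity :: "(mat3 \<Rightarrow> mat3 \<Rightarrow> real) \<Rightarrow> (real \<Rightarrow> mat3 measure) \<Rightarrow> mat3 \<Rightarrow> real \<Rightarrow> mat3" where
  "velocity K \<rho> R t = - (LINT Q|\<rho> t. grad_SO3 (\<lambda>R'. K R' Q) R)"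

definition is_flow_map ::
  "('a::real_normed_vector \<Rightarrow> real \<Rightarrow> 'a) \<Rightarrow> 'a set \<Rightarrow> 'a set \<Rightarrow> (real \<Rightarrow> 'a \<Rightarrow> 'a) \<Rightarrow> bool" where
  "is_flow_map v A S \<Psi> \<longleftrightarrow>
     (\<forall>R\<in>A. \<Psi> 0 R = R \<and>
        (\<forall>t\<ge>0. \<Psi> t R \<in> S \<and>
           ((\<lambda>\<tau>. \<Psi> \<tau> R) has_vector_derivative v (\<Psi> t R) t) (at t within {0..})))"

text \<open>
  Since the flow map is only defined on the support of \<open>\<rho>\<^sub>0\<close>, the push-forward is that of the
  restriction of \<open>\<rho>\<^sub>0\<close> to its support (a closed set of full measure).
\<close>

definition global_weak_solution ::
  "mat3 set \<Rightarrow> (mat3 \<Rightarrow> mat3 \<Rightarrow> real) \<Rightarrow> mat3 measure \<Rightarrow> (real \<Rightarrow> mat3 measure) \<Rightarrow> bool" where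
  "global_weak_solution S K \<rho>\<^sub>0 \<rho> \<longleftrightarrow>
     (\<forall>t\<ge>0. \<rho> t \<in> prob_measures S) \<and>
     (\<exists>\<Psi>. is_flow_map (velocity K \<rho>) (msupp \<rho>\<^sub>0) S \<Psi> \<and>
          (\<forall>\<Phi>. is_flow_map (velocity K \<rho>) (msupp \<rho>\<^sub>0) S \<Phi> \<longrightarrow>
               (\<forall>t\<ge>0. \<forall>R\<in>msupp \<rho>\<^sub>0. \<Phi> t R = \<Psi> t R)) \<and>
          (\<forall>t\<ge>0. \<Psi> t \<in> restrict_space \<rho>\<^sub>0 (msupp \<rho>\<^sub>0) \<rightarrow>\<^sub>M restrict_space borel S \<and>
                 \<rho> t = distr (restrict_space \<rho>\<^sub>0 (msupp \<rho>\<^sub>0)) (restrict_space borel S) (\<Psi> t)))"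

definition h_fun :: "(real \<Rightarrow> real) \<Rightarrow> real \<Rightarrow> real" where
  "h_fun g' s = (if s = 0 then g' 0 else s / sin s * g' (s\<^sup>2))"

end

theory Submission
  imports Defs
begin

text \<open>
  Write \<open>R \<bullet> Q = trace (transpose R ** Q) = 1 + 2 * cos (geo_dist R Q)\<close>. The Riemannian gradient of
  \<open>g (d(\<cdot>, Q)\<^sup>2)\<close> at \<open>R\<close> is \<open>- h(d(R, Q)) (Q - R Q\<^sup>T R)\<close> (lemma \<open>grad_kernel\<close>), so along the flow every
  particle moves towards the others: \<open>x\<^sub>i' = \<integral> h(d(x\<^sub>i, x\<^sub>j)) (x\<^sub>j - x\<^sub>i x\<^sub>j\<^sup>T x\<^sub>i) d\<mu>(j)\<close>. Rotations in the
  ball \<open>\<D>\<close> of radius \<open>pi/2 - \<epsilon>\<close> lift to unit quaternions that have pairwise inner products at least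
  \<open>sin \<epsilon>\<close>, and for quaternion lifts \<open>c, r, s\<close> of \<open>C, R, S\<close> (lemma \<open>inner_drift\<close>)
  \<open>C \<bullet> (S - R S\<^sup>T R) = 16 (c \<bullet> r) (r \<bullet> s) (c \<bullet> s - (c \<bullet> r) (r \<bullet> s))\<close>.

  If \<open>R\<close> is the particle farthest from \<open>C\<close>, then \<open>c \<bullet> s \<ge> c \<bullet> r\<close> and the right-hand side is nonnegative.
  Hence a ball around any centre in \<open>\<D>\<close> that contains all particles contains them at all later times
  (lemma \<open>ball_invariance\<close>).

  If \<open>P, R\<close> are two particles at maximal distance, then no particle \<open>S\<close> pushes them apart, and the
  one of \<open>P, R\<close> that is farther from \<open>S\<close> is pulled by \<open>S\<close> towards the other one at a rate bounded below
  in terms of the distance of \<open>P\<close> and \<open>R\<close>, because \<open>h\<close> is positive and non-decreasing (lemma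
  \<open>pair_interaction_ge\<close>). So the diameter becomes arbitrarily small (lemma \<open>concentration\<close>).

  Small diameter at a time \<open>T\<close> means that all particles lie in a small ball around any one of them;
  by invariance they stay there. The particles are therefore uniformly Cauchy and converge
  uniformly to one point \<open>P\<close> (theorem \<open>consensus\<close>), which remains in the invariant ball of radius
  \<open>r\<close> around the identity. Uniform convergence gives \<open>W1\<close>-convergence to the Dirac mass at \<open>P\<close>.

  Since the set of particles is arbitrary and need not be compact, extremal particles need not exist;
  the two arguments are carried out with infima of families of differentiable functions (lemma
  \<open>INF_family_growth\<close>).
\<close>

section \<open>Rotations and unit quaternions\<close>

lemma trace_transpose_mult_inner:
  fixes A B :: "real^'n^'m" shows "trace (transpose A ** B) = A \<bullet> B"
proof -
  have "trace (transpose A ** B) = (\<Sum>j\<in>UNIV. \<Sum>i\<in>UNIV. A $ i $ j * B $ i $ j)"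
    by (simp add: trace_def matrix_matrix_mult_def transpose_def)
  also have "\<dots> = (\<Sum>i\<in>UNIV. \<Sum>j\<in>UNIV. A $ i $ j * B $ i $ j)"
    by (rule sum.swap)
  finally show ?thesis by (simp add: inner_vec_def)
qed

text \<open>
  The Euler-Rodrigues matrix of a quaternion \<open>q = a + b i + c j + d k\<close>: the matrix of
  \<open>v \<mapsto> q v q\<^sup>*\<close> on imaginary quaternions. It is defined for all \<open>q\<close>, homogeneous of degree two, and a
  rotation for unit \<open>q\<close>; \<open>q\<close> and \<open>- q\<close> have the same matrix.
\<close>

definition rotq :: "real^4 \<Rightarrow> mat3" where
  "rotq q = (let a = q$1; b = q$2; c = q$3; d = q$4 in
     vector [vector [a^2 + b^2 - c^2 - d^2, 2 * (b*c - a*d), 2 * (b*d + a*c)],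
             vector [2 * (b*c + a*d), a^2 - b^2 + c^2 - d^2, 2 * (c*d - a*b)],
             vector [2 * (b*d - a*c), 2 * (c*d + a*b), a^2 - b^2 - c^2 + d^2]])"

text \<open>
  For unit quaternions this is the double-angle formula: their distance on the sphere (modulo
  sign) is half the geodesic distance of the rotations.
\<close>

lemma rotq_inner: "rotq p \<bullet> rotq q = 4 * (p \<bullet> q)^2 - (p \<bullet> p) * (q \<bullet> q)"
  unfolding rotq_def Let_def
  by (simp add: inner_vec_def sum_3 sum_4; algebra)

lemma rotq_orth: "transpose (rotq q) ** rotq q = ((q \<bullet> q)^2) *\<^sub>R mat 1"
  unfolding rotq_def Let_def vec_eq_iff forall_3
  by (simp add: matrix_matrix_mult_def transpose_def inner_vec_def sum_3 sum_4 mat_def; algebra)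

lemma rotq_det: "det (rotq q) = (q \<bullet> q)^3"
  unfolding rotq_def Let_def
  by (simp add: det_3 inner_vec_def sum_4; algebra)

text \<open>
  The geodesic symmetry \<open>S \<mapsto> R S\<^sup>T R\<close> of the rotation group at \<open>R\<close> becomes the geodesic
  symmetry \<open>s \<mapsto> 2 (r \<bullet> s) r - s\<close> of the sphere at \<open>r\<close> if \<open>r\<close> and \<open>s\<close> are unit quaternions.
\<close>

lemma rotq_reflect:
  "rotq r ** transpose (rotq s) ** rotq r = rotq ((2 * (r \<bullet> s)) *\<^sub>R r - (r \<bullet> r) *\<^sub>R s)"
  unfolding rotq_def Let_def vec_eq_iff forall_3
  by (simp add: matrix_matrix_mult_def transpose_def inner_vec_def sum_3 sum_4, intro conjI; algebra)

lemma SO3_iff: "R \<in> SO3 \<longleftrightarrow> transpose R ** R = mat 1 \<and> det R = 1"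
  by (simp add: SO3_def rotation_matrix_def orthogonal_matrix)


lemma SO3_cofactor:
  assumes "R \<in> SO3"
  shows "R$1$1 = R$2$2 * R$3$3 - R$2$3 * R$3$2" "R$1$2 = R$2$3 * R$3$1 - R$2$1 * R$3$3"
    "R$1$3 = R$2$1 * R$3$2 - R$2$2 * R$3$1" "R$2$1 = R$1$3 * R$3$2 - R$1$2 * R$3$3"
    "R$2$2 = R$1$1 * R$3$3 - R$1$3 * R$3$1" "R$2$3 = R$1$2 * R$3$1 - R$1$1 * R$3$2"
    "R$3$1 = R$1$2 * R$2$3 - R$1$3 * R$2$2" "R$3$2 = R$1$3 * R$2$1 - R$1$1 * R$2$3"
    "R$3$3 = R$1$1 * R$2$2 - R$1$2 * R$2$1"
proof -
  have R: "rotation_matrix R" using assms by (simp add: SO3_def)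
  note c = cross_rotation_matrix[OF R]
  show "R$1$1 = R$2$2 * R$3$3 - R$2$3 * R$3$2" "R$1$2 = R$2$3 * R$3$1 - R$2$1 * R$3$3"
    "R$1$3 = R$2$1 * R$3$2 - R$2$2 * R$3$1" "R$2$1 = R$1$3 * R$3$2 - R$1$2 * R$3$3"
    "R$2$2 = R$1$1 * R$3$3 - R$1$3 * R$3$1" "R$2$3 = R$1$2 * R$3$1 - R$1$1 * R$3$2"
    "R$3$1 = R$1$2 * R$2$3 - R$1$3 * R$2$2" "R$3$2 = R$1$3 * R$2$1 - R$1$1 * R$2$3"
    "R$3$3 = R$1$1 * R$2$2 - R$1$2 * R$2$1"
    using c[of "axis 1 1" "axis 2 1"] c[of "axis 2 1" "axis 3 1"] c[of "axis 3 1" "axis 1 1"]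
    by (simp_all add: cross3_simps axis_def matrix_vector_mult_def sum_3 vec_eq_iff forall_3)
qed

lemma SO3_entries:
  assumes "R \<in> SO3"
  shows "R$1$1 * R$1$1 + R$2$1 * R$2$1 + R$3$1 * R$3$1 = 1"
    "R$1$2 * R$1$2 + R$2$2 * R$2$2 + R$3$2 * R$3$2 = 1"
    "R$1$3 * R$1$3 + R$2$3 * R$2$3 + R$3$3 * R$3$3 = 1"
    "R$1$1 * R$1$1 + R$1$2 * R$1$2 + R$1$3 * R$1$3 = 1"
    "R$2$1 * R$2$1 + R$2$2 * R$2$2 + R$2$3 * R$2$3 = 1"
    "R$3$1 * R$3$1 + R$3$2 * R$3$2 + R$3$3 * R$3$3 = 1"
    "R$1$1 * R$1$2 + R$2$1 * R$2$2 + R$3$1 * R$3$2 = 0"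
    "R$1$1 * R$1$3 + R$2$1 * R$2$3 + R$3$1 * R$3$3 = 0"
    "R$1$2 * R$1$3 + R$2$2 * R$2$3 + R$3$2 * R$3$3 = 0"
    "R$1$1 * R$2$1 + R$1$2 * R$2$2 + R$1$3 * R$2$3 = 0"
    "R$1$1 * R$3$1 + R$1$2 * R$3$2 + R$1$3 * R$3$3 = 0"
    "R$2$1 * R$3$1 + R$2$2 * R$3$2 + R$2$3 * R$3$3 = 0"
proof -
  have "transpose R ** R = mat 1" "R ** transpose R = mat 1"
    using assms by (simp_all add: SO3_def rotation_matrix_def orthogonal_matrix_def)
  then show "R$1$1 * R$1$1 + R$2$1 * R$2$1 + R$3$1 * R$3$1 = 1"
    "R$1$2 * R$1$2 + R$2$2 * R$2$2 + R$3$2 * R$3$2 = 1"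
    "R$1$3 * R$1$3 + R$2$3 * R$2$3 + R$3$3 * R$3$3 = 1"
    "R$1$1 * R$1$1 + R$1$2 * R$1$2 + R$1$3 * R$1$3 = 1"
    "R$2$1 * R$2$1 + R$2$2 * R$2$2 + R$2$3 * R$2$3 = 1"
    "R$3$1 * R$3$1 + R$3$2 * R$3$2 + R$3$3 * R$3$3 = 1"
    "R$1$1 * R$1$2 + R$2$1 * R$2$2 + R$3$1 * R$3$2 = 0"
    "R$1$1 * R$1$3 + R$2$1 * R$2$3 + R$3$1 * R$3$3 = 0"
    "R$1$2 * R$1$3 + R$2$2 * R$2$3 + R$3$2 * R$3$3 = 0"
    "R$1$1 * R$2$1 + R$1$2 * R$2$2 + R$1$3 * R$2$3 = 0"
    "R$1$1 * R$3$1 + R$1$2 * R$3$2 + R$1$3 * R$3$3 = 0"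
    "R$2$1 * R$3$1 + R$2$2 * R$3$2 + R$2$3 * R$3$3 = 0"
    by (simp_all add: vec_eq_iff forall_3 matrix_matrix_mult_def transpose_def sum_3 mat_def)
qed

lemma rotq_scaleR: "rotq (c *\<^sub>R q) = c^2 *\<^sub>R rotq q"
  unfolding rotq_def Let_def vec_eq_iff forall_3
  by (simp; algebra)

lemma rotq_in_SO3: "norm q = 1 \<Longrightarrow> rotq q \<in> SO3"
  by (simp add: SO3_iff rotq_orth rotq_det norm_eq_1)

lemma rotq_normalized_in_SO3: "q \<noteq> 0 \<Longrightarrow> (1 / (q \<bullet> q)) *\<^sub>R rotq q \<in> SO3"
  using rotq_in_SO3[of "(1 / norm q) *\<^sub>R q"]
  by (simp add: rotq_scaleR power_divide power2_norm_eq_inner)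

lemma rotq_axis1: "rotq (axis 1 1) = mat 1"
  unfolding rotq_def Let_def vec_eq_iff forall_3 by (simp add: axis_def mat_def)

lemma inner_axis1: "axis 1 1 \<bullet> (q::real^4) = q $ 1"
  by (simp add: inner_axis')

text \<open>
  For \<open>T > 0\<close> the vector \<open>u\<close> is \<open>4 q\<^sub>0 q\<close>, where \<open>q\<close> is the unit quaternion of \<open>R\<close> with real part
  \<open>q\<^sub>0 > 0\<close>. The identities are linear consequences of the orthonormality and cofactor relations
  between the products of entries of \<open>R\<close>; they hold without any assumption on \<open>T\<close>, and
  \<open>u \<bullet> u = 4 T\<close> shows that \<open>T \<ge> 0\<close>.
\<close>

lemma SO3_quaternion:
  assumes R: "R \<in> SO3"
  defines "T \<equiv> 1 + mat 1 \<bullet> R"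
  obtains u :: "real^4" where "u $ 1 = T" "u \<bullet> u = 4 * T" "rotq u = (4 * T) *\<^sub>R R"
proof -
  have T: "T = 1 + R$1$1 + R$2$2 + R$3$3"
    by (simp add: T_def inner_vec_def sum_3 mat_def)
  define u :: "real^4" where
    "u = (\<chi> i. if i = 1 then T else if i = 2 then R$3$2 - R$2$3
               else if i = 3 then R$1$3 - R$3$1 else R$2$1 - R$1$2)"
  have u: "u$1 = T" "u$2 = R$3$2 - R$2$3" "u$3 = R$1$3 - R$3$1" "u$4 = R$2$1 - R$1$2"
    by (simp_all add: u_def)
  note e = SO3_cofactor[OF R, simplified algebra_simps] SO3_entries[OF R, simplified algebra_simps]
  have "u \<bullet> u = 4 * T"
    unfolding inner_vec_def sum_4 u T
    by (simp add: algebra_simps) (insert e, linarith)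
  moreover have "rotq u = (4 * T) *\<^sub>R R"
    unfolding vec_eq_iff forall_3 rotq_def Let_def u T
    by (simp add: algebra_simps power2_eq_square, intro conjI; insert e; linarith)
  ultimately show thesis using that u(1) by blast
qed

lemma rotq_surj:
  assumes R: "R \<in> SO3" and T: "mat 1 \<bullet> R > -1"
  obtains q where "norm q = 1" "q $ 1 > 0" "R = rotq q"
proof -
  define T where "T = 1 + mat 1 \<bullet> R"
  have T0: "T > 0" using T by (simp add: T_def)
  obtain u :: "real^4" where u: "u $ 1 = T" "u \<bullet> u = 4 * T" "rotq u = (4 * T) *\<^sub>R R"
    using SO3_quaternion[OF R] T_def by metis
  have nu: "norm u = 2 * sqrt T" by (simp add: norm_eq_sqrt_inner u real_sqrt_mult)
  show thesis
  proof (rule that)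
    show "norm ((1 / norm u) *\<^sub>R u) = 1" using T0 nu by simp
    show "((1 / norm u) *\<^sub>R u) $ 1 > 0" using T0 nu u by simp
    show "R = rotq ((1 / norm u) *\<^sub>R u)"
      using T0 by (simp add: rotq_scaleR u nu power_divide)
  qed
qed

section \<open>The geometry of the rotation group\<close>

lemma SO3_orth: "R \<in> SO3 \<Longrightarrow> transpose R ** R = mat 1" "R \<in> SO3 \<Longrightarrow> R ** transpose R = mat 1"
  by (simp_all add: SO3_def rotation_matrix_def orthogonal_matrix_def)

lemma SO3_transpose_mult: "R \<in> SO3 \<Longrightarrow> Q \<in> SO3 \<Longrightarrow> transpose R ** Q \<in> SO3"
  by (simp add: SO3_def rotation_matrix_def orthogonal_matrix_mul orthogonal_matrix_transpose
      det_mul det_transpose)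

lemma SO3_mult: "R \<in> SO3 \<Longrightarrow> Q \<in> SO3 \<Longrightarrow> R ** Q \<in> SO3"
  by (simp add: SO3_def rotation_matrix_def orthogonal_matrix_mul det_mul)

lemma mat1_in_SO3: "mat 1 \<in> SO3"
  by (simp add: SO3_iff)

lemma inner_transpose_mult:
  fixes A B C :: mat3
  shows "(A ** B) \<bullet> C = B \<bullet> (transpose A ** C)"
  by (simp add: trace_transpose_mult_inner[symmetric] matrix_transpose_mul matrix_mul_assoc)

lemma inner_transpose:
  fixes A B :: mat3
  shows "transpose A \<bullet> transpose B = A \<bullet> B"
  by (simp add: inner_vec_def transpose_def sum_3)

lemma SO3_inner_self: "R \<in> SO3 \<Longrightarrow> R \<bullet> R = 3"
  using SO3_orth(1)[of R] trace_transpose_mult_inner[of R R]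
  by (simp add: trace_def mat_def sum_3)

lemma SO3_norm: "R \<in> SO3 \<Longrightarrow> norm R = sqrt 3"
  by (simp add: norm_eq_sqrt_inner SO3_inner_self)

lemma SO3_inner_le: "R \<in> SO3 \<Longrightarrow> Q \<in> SO3 \<Longrightarrow> R \<bullet> Q \<le> 3"
  using norm_cauchy_schwarz[of R Q] by (simp add: SO3_norm)

lemma SO3_inner_ge:
  assumes "R \<in> SO3" "Q \<in> SO3" shows "R \<bullet> Q \<ge> -1"
proof -
  have "mat 1 \<bullet> (transpose R ** Q) = R \<bullet> Q"
    using inner_transpose_mult[of R "mat 1" Q] by simp
  moreover obtain u :: "real^4" where "u \<bullet> u = 4 * (1 + mat 1 \<bullet> (transpose R ** Q))"
    using SO3_quaternion[OF SO3_transpose_mult[OF assms]] by metis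
  ultimately show ?thesis using inner_ge_zero[of u] by simp
qed

lemma geo_dist_inner: "geo_dist R Q = arccos ((R \<bullet> Q - 1) / 2)"
  by (simp add: geo_dist_def trace_transpose_mult_inner)

lemma geo_dist_bounds:
  assumes "R \<in> SO3" "Q \<in> SO3" shows "0 \<le> geo_dist R Q" "geo_dist R Q \<le> pi"
  using SO3_inner_le[OF assms] SO3_inner_ge[OF assms]
  by (simp_all add: geo_dist_inner arccos_lbound arccos_ubound)

lemma cos_geo_dist:
  assumes "R \<in> SO3" "Q \<in> SO3" shows "cos (geo_dist R Q) = (R \<bullet> Q - 1) / 2"
  using SO3_inner_le[OF assms] SO3_inner_ge[OF assms]
  by (simp add: geo_dist_inner cos_arccos)

lemma geo_dist_less_iff:
  assumes "R \<in> SO3" "Q \<in> SO3" "0 \<le> \<delta>" "\<delta> \<le> pi"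
  shows "geo_dist R Q < \<delta> \<longleftrightarrow> R \<bullet> Q > 1 + 2 * cos \<delta>"
proof -
  have "geo_dist R Q < \<delta> \<longleftrightarrow> cos \<delta> < cos (geo_dist R Q)"
    using assms geo_dist_bounds[OF assms(1,2)] by (intro cos_mono_less_eq[symmetric]) auto
  then show ?thesis by (simp add: cos_geo_dist assms) linarith
qed

lemma geo_dist_le_iff:
  assumes "R \<in> SO3" "Q \<in> SO3" "0 \<le> \<delta>" "\<delta> \<le> pi"
  shows "geo_dist R Q \<le> \<delta> \<longleftrightarrow> R \<bullet> Q \<ge> 1 + 2 * cos \<delta>"
proof -
  have "geo_dist R Q \<le> \<delta> \<longleftrightarrow> cos \<delta> \<le> cos (geo_dist R Q)"
    using assms geo_dist_bounds[OF assms(1,2)] by (intro cos_mono_le_eq[symmetric]) auto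
  then show ?thesis by (simp add: cos_geo_dist assms) linarith
qed

lemma geo_ball_iff:
  assumes "0 \<le> \<delta>" "\<delta> \<le> pi"
  shows "R \<in> geo_ball \<delta> \<longleftrightarrow> R \<in> SO3 \<and> mat 1 \<bullet> R > 1 + 2 * cos \<delta>"
  unfolding geo_ball_def mem_Collect_eq using geo_dist_less_iff[OF mat1_in_SO3 _ assms] by blast

lemma closed_SO3: "closed SO3"
proof -
  have "closed {R::mat3. transpose R ** R = mat 1}"
    unfolding matrix_matrix_mult_def transpose_def
    by (intro closed_Collect_eq continuous_intros)
  moreover have "closed {R::mat3. det R = 1}"
    unfolding det_3 by (intro closed_Collect_eq continuous_intros)
  ultimately have "closed ({R::mat3. transpose R ** R = mat 1} \<inter> {R. det R = 1})"
    by (rule closed_Int)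
  moreover have "SO3 = {R::mat3. transpose R ** R = mat 1} \<inter> {R. det R = 1}"
    using SO3_iff by blast
  ultimately show ?thesis by (rule ssubst[rotated])
qed

text \<open>
  The tangent vector at \<open>R\<close> that points towards \<open>S\<close>: for \<open>\<theta> = geo_dist R S < pi\<close> it is
  \<open>2 sin \<theta> / \<theta>\<close> times the Riemannian logarithm of \<open>S\<close> at \<open>R\<close> (and \<open>0\<close> for \<open>S = R\<close>).
\<close>

definition drift :: "mat3 \<Rightarrow> mat3 \<Rightarrow> mat3" where
  "drift R S = S - R ** transpose S ** R"

lemma norm_drift_le:
  assumes "R \<in> SO3" "S \<in> SO3" shows "norm (drift R S) \<le> 4"
proof -
  have "transpose S \<in> SO3" using SO3_transpose_mult[OF assms(2) mat1_in_SO3] by simp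
  then have "R ** transpose S ** R \<in> SO3" using assms by (simp add: SO3_mult)
  then have "norm (drift R S) \<le> sqrt 3 + sqrt 3"
    unfolding drift_def using norm_triangle_ineq4[of S "R ** transpose S ** R"]
    by (simp add: SO3_norm assms)
  also have "\<dots> \<le> 4" using real_sqrt_le_mono[of 3 4] by simp
  finally show ?thesis .
qed

text \<open>
  The rate at which \<open>C \<bullet> R\<close> changes when \<open>R\<close> moves along \<open>drift R S\<close>. If the three inner products of
  the lifts are positive, it is nonnegative as soon as \<open>S\<close> is at least as close to \<open>C\<close> as \<open>R\<close> is.
\<close>

lemma inner_drift:
  assumes "norm c = 1" "norm r = 1" "norm s = 1"
  shows "rotq c \<bullet> drift (rotq r) (rotq s) =
    16 * (c \<bullet> r) * (r \<bullet> s) * (c \<bullet> s - (c \<bullet> r) * (r \<bullet> s))"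
proof -
  let ?q = "(2 * (r \<bullet> s)) *\<^sub>R r - s"
  have n: "c \<bullet> c = 1" "r \<bullet> r = 1" "s \<bullet> s = 1" using assms by (simp_all add: norm_eq_1)
  have q: "?q \<bullet> ?q = 1"
    by (simp add: inner_diff_left inner_diff_right n inner_commute power2_eq_square algebra_simps)
  have "rotq c \<bullet> drift (rotq r) (rotq s) = rotq c \<bullet> rotq s - rotq c \<bullet> rotq ?q"
    by (simp add: drift_def rotq_reflect n inner_diff_right)
  also have "\<dots> = 4 * (c \<bullet> s)^2 - 4 * (c \<bullet> ?q)^2"
    by (simp only: rotq_inner n q)
  also have "\<dots> = 16 * (c \<bullet> r) * (r \<bullet> s) * (c \<bullet> s - (c \<bullet> r) * (r \<bullet> s))"
    by (simp add: inner_diff_right) algebra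
  finally show ?thesis .
qed

text \<open>
  The unit quaternion with positive real part of a rotation by an angle less than \<open>pi\<close>; it is
  unspecified for rotations by the angle \<open>pi\<close>.
\<close>

definition quat_lift :: "mat3 \<Rightarrow> real^4" where
  "quat_lift R = (SOME q. norm q = 1 \<and> q $ 1 > 0 \<and> R = rotq q)"

lemma quat_lift:
  assumes "R \<in> SO3" "mat 1 \<bullet> R > -1"
  shows "norm (quat_lift R) = 1" "quat_lift R $ 1 > 0" "rotq (quat_lift R) = R"
proof -
  have "norm (quat_lift R) = 1 \<and> quat_lift R $ 1 > 0 \<and> R = rotq (quat_lift R)"
    unfolding quat_lift_def by (rule someI_ex) (use rotq_surj[OF assms] in metis)
  then show "norm (quat_lift R) = 1" "quat_lift R $ 1 > 0" "rotq (quat_lift R) = R" by metis+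
qed

lemma geo_ball_lift:
  assumes "0 < \<epsilon>" "\<epsilon> < pi/2" "R \<in> geo_ball (pi/2 - \<epsilon>)"
  shows "R \<in> SO3" "norm (quat_lift R) = 1" "rotq (quat_lift R) = R" "quat_lift R $ 1 > 0" "(quat_lift R $ 1)\<^sup>2 \<ge> (1 + sin \<epsilon>) / 2"
proof -
  have s: "sin \<epsilon> > 0" using assms by (simp add: sin_gt_zero)
  have c: "cos (pi/2 - \<epsilon>) = sin \<epsilon>" by (simp add: cos_diff)
  have R: "R \<in> SO3" "mat 1 \<bullet> R > 1 + 2 * sin \<epsilon>"
    using assms geo_ball_iff[of "pi/2 - \<epsilon>" R] by (auto simp: c)
  then have l: "norm (quat_lift R) = 1" "quat_lift R $ 1 > 0" "rotq (quat_lift R) = R"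
    using quat_lift[of R] s by auto
  show "R \<in> SO3" "norm (quat_lift R) = 1" "rotq (quat_lift R) = R" "quat_lift R $ 1 > 0" by fact+
  have "rotq (axis 1 1) \<bullet> rotq (quat_lift R) = 4 * (quat_lift R $ 1)^2 - 1"
    unfolding rotq_inner using l(1) by (simp add: inner_axis1 norm_eq_1)
  then show "(quat_lift R $ 1)\<^sup>2 \<ge> (1 + sin \<epsilon>) / 2"
    using R l by (simp add: rotq_axis1)
qed

text \<open>
  The lifts lie in the spherical cap of angular radius \<open>pi/4 - \<epsilon>/2\<close> around the quaternion \<open>1\<close>, hence
  at an angle of at most \<open>pi/2 - \<epsilon>\<close> from each other. This is where the radius \<open>pi/2 - \<epsilon>\<close> matters: no
  sign ambiguity arises when the lifts are compared.
\<close>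

lemma lift_inner_ge:
  assumes e: "0 < \<epsilon>" "\<epsilon> < pi/2" and R: "R \<in> geo_ball (pi/2 - \<epsilon>)" and S: "S \<in> geo_ball (pi/2 - \<epsilon>)"
  shows "quat_lift R \<bullet> quat_lift S \<ge> sin \<epsilon>"
proof -
  let ?p = "quat_lift R" let ?q = "quat_lift S"
  let ?p' = "?p - (?p$1) *\<^sub>R axis 1 1" and ?q' = "?q - (?q$1) *\<^sub>R axis 1 1"
  note p = geo_ball_lift[OF e R] and q = geo_ball_lift[OF e S]
  have pp: "?p \<bullet> ?p = 1" "?q \<bullet> ?q = 1" using p q by (simp_all add: norm_eq_1)
  have ax: "axis 1 1 \<bullet> (axis 1 1 :: real^4) = 1" by (simp add: inner_axis1)
  have ax': "v \<bullet> axis 1 1 = v $ 1" for v :: "real^4" by (simp add: inner_axis)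
  have n: "?p' \<bullet> ?p' = 1 - (?p$1)^2" "?q' \<bullet> ?q' = 1 - (?q$1)^2" "?p' \<bullet> ?q' = ?p \<bullet> ?q - ?p$1 * ?q$1"
    using pp by (simp_all add: inner_diff_left inner_diff_right inner_axis1 ax ax' power2_eq_square)
  have "0 \<le> (?p' + ?q') \<bullet> (?p' + ?q')" by (rule inner_ge_zero)
  also have "\<dots> = ?p' \<bullet> ?p' + 2 * (?p' \<bullet> ?q') + ?q' \<bullet> ?q'"
    by (simp only: inner_add_left inner_add_right inner_commute[of ?q' ?p'])
  finally have 1: "2 * (?p \<bullet> ?q) \<ge> 2 * (?p$1 * ?q$1) + (?p$1)^2 + (?q$1)^2 - 2"
    unfolding n by simp
  have "((1 + sin \<epsilon>) / 2)^2 \<le> (?p$1)^2 * (?q$1)^2"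
    unfolding power2_eq_square[of "(1 + sin \<epsilon>) / 2"] using p q sin_gt_zero[of \<epsilon>] e
    by (intro mult_mono) auto
  then have "(1 + sin \<epsilon>) / 2 \<le> ?p$1 * ?q$1"
    using power2_le_imp_le[of "(1 + sin \<epsilon>) / 2" "?p$1 * ?q$1"] mult_pos_pos[OF p(4) q(4)]
    unfolding power_mult_distrib by linarith
  moreover have "s \<le> x" if "(1 + s) / 2 \<le> y" "2 * y + a + b - 2 \<le> 2 * x" "(1 + s) / 2 \<le> a"
    "(1 + s) / 2 \<le> b" for s x y a b :: real
    using that by (simp add: field_simps)
  ultimately show ?thesis using 1 p(5) q(5) by blast
qed

lemma lift_inner_le:
  assumes "norm p = 1" "norm q = 1" shows "p \<bullet> q \<le> 1"
  using norm_cauchy_schwarz[of p q] assms by simp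

lemma inner_rotq_unit:
  assumes "norm p = 1" "norm q = 1" shows "rotq p \<bullet> rotq q = 4 * (p \<bullet> q)^2 - 1"
  unfolding rotq_inner using assms by (simp add: norm_eq_1)

lemma geo_ball_coordinates:
  assumes eps: "0 < \<epsilon>" "\<epsilon> < pi/2"
    and RS: "R \<in> geo_ball (pi/2 - \<epsilon>)" "S \<in> geo_ball (pi/2 - \<epsilon>)"
  shows "quat_lift R \<bullet> quat_lift S > 0" "quat_lift R \<bullet> quat_lift S \<ge> sin \<epsilon>" "quat_lift R \<bullet> quat_lift S \<le> 1"
    "R \<bullet> S = 4 * (quat_lift R \<bullet> quat_lift S)\<^sup>2 - 1"
proof -
  note R = geo_ball_lift(1-3)[OF eps RS(1)] and S = geo_ball_lift(1-3)[OF eps RS(2)]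
  show "quat_lift R \<bullet> quat_lift S \<ge> sin \<epsilon>" by (rule lift_inner_ge[OF eps RS])
  then show "quat_lift R \<bullet> quat_lift S > 0" using eps sin_gt_zero[of \<epsilon>] by linarith
  show "quat_lift R \<bullet> quat_lift S \<le> 1" by (rule lift_inner_le[OF R(2) S(2)])
  show "R \<bullet> S = 4 * (quat_lift R \<bullet> quat_lift S)\<^sup>2 - 1"
    using inner_rotq_unit[OF R(2) S(2)] unfolding R(3) S(3) .
qed

lemma geo_ball_geo_dist:
  assumes eps: "0 < \<epsilon>" "\<epsilon> < pi/2"
    and RS: "R \<in> geo_ball (pi/2 - \<epsilon>)" "S \<in> geo_ball (pi/2 - \<epsilon>)"
  shows "0 \<le> geo_dist R S" "geo_dist R S \<le> pi - 2 * \<epsilon>"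
proof -
  note R = RS[THEN geo_ball_lift(1)[OF eps]]
  show "0 \<le> geo_dist R S" using geo_dist_bounds[OF R] by blast
  have "(sin \<epsilon>)\<^sup>2 \<le> (quat_lift R \<bullet> quat_lift S)\<^sup>2"
    using geo_ball_coordinates(2)[OF eps RS] eps sin_gt_zero[of \<epsilon>] by (intro power_mono) auto
  then have "R \<bullet> S \<ge> 1 + 2 * cos (pi - 2 * \<epsilon>)"
    using geo_ball_coordinates(4)[OF eps RS] by (simp add: cos_diff cos_double_sin)
  then show "geo_dist R S \<le> pi - 2 * \<epsilon>" using geo_dist_le_iff[OF R, of "pi - 2 * \<epsilon>"] eps by simp
qed

lemma continuous_on_geo_dist:
  assumes "R \<in> SO3" "S \<subseteq> SO3" shows "continuous_on S (geo_dist R)"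
proof -
  have "continuous_on S (\<lambda>Q. arccos ((R \<bullet> Q - 1) / 2))"
  proof (intro continuous_on_arccos continuous_intros ballI)
    fix Q assume "Q \<in> S"
    then show "-1 \<le> (R \<bullet> Q - 1) / 2 \<and> (R \<bullet> Q - 1) / 2 \<le> 1"
      using SO3_inner_ge[OF assms(1), of Q] SO3_inner_le[OF assms(1), of Q] assms(2) by auto
  qed auto
  then show ?thesis by (simp add: geo_dist_inner[abs_def])
qed

lemma interaction_measurable:
  assumes R: "R \<in> SO3" and S: "S \<subseteq> SO3" and S': "\<And>Q. Q \<in> S \<Longrightarrow> geo_dist R Q < pi"
    and h: "mono_on {0..<pi} h"
  shows "(\<lambda>Q. h (geo_dist R Q) *\<^sub>R drift R Q) \<in> borel_measurable (restrict_space borel S)"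
proof -
  have "geo_dist R \<in> restrict_space borel S \<rightarrow>\<^sub>M restrict_space borel {0..<pi}"
    using geo_dist_bounds[OF R] S S'
    by (intro measurable_restrict_space2 borel_measurable_continuous_on_restrict continuous_on_geo_dist[OF R S])
      (auto simp: space_restrict_space)
  then have "(\<lambda>Q. h (geo_dist R Q)) \<in> borel_measurable (restrict_space borel S)"
    by (rule measurable_compose) (rule borel_measurable_mono_on_fnc[OF h])
  moreover have "drift R \<in> borel_measurable (restrict_space borel S)"
    unfolding drift_def[abs_def] matrix_matrix_mult_def transpose_def
    by (intro borel_measurable_continuous_on_restrict continuous_intros)
  ultimately show ?thesis by (rule borel_measurable_scaleR)
qed

section \<open>The gradient of a radial kernel\<close>

lemma matrix_mult_diff: fixes A B C :: mat3 shows "A ** (B - C) = A ** B - A ** C"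
  by (simp add: vec_eq_iff matrix_matrix_mult_def sum_subtractf right_diff_distrib)

lemma transpose_linear:
  fixes A B :: mat3
  shows "transpose (A - B) = transpose A - transpose B" "transpose (c *\<^sub>R A) = c *\<^sub>R transpose A"
    "transpose (- A) = - transpose A"
  by (simp_all add: vec_eq_iff transpose_def)

lemma matrix_mult_scaleR:
  fixes A B :: mat3 shows "A ** (c *\<^sub>R B) = c *\<^sub>R (A ** B)" "(c *\<^sub>R A) ** B = c *\<^sub>R (A ** B)"
  by (simp_all add: vec_eq_iff matrix_matrix_mult_def sum_distrib_left mult_ac)

text \<open>
  The curve is \<open>R\<close> times the rotation of the quaternion \<open>1 + t w\<close>, normalized, where \<open>w\<close> is half the axial
  vector of the skew-symmetric matrix \<open>transpose R ** X\<close>.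
\<close>

lemma tangent_curve:
  assumes R: "R \<in> SO3" and X: "X \<in> tangent_SO3 R"
  obtains \<gamma> :: "real \<Rightarrow> mat3"
  where "\<And>t. \<gamma> t \<in> SO3" "\<gamma> 0 = R" "(\<gamma> has_vector_derivative X) (at 0)"
proof -
  obtain A where A: "X = R ** A" "transpose A = - A" using X by (auto simp: tangent_SO3_def)
  have skew: "A$1$1 = 0" "A$2$2 = 0" "A$3$3 = 0" "A$1$2 = - A$2$1" "A$2$3 = - A$3$2" "A$3$1 = - A$1$3"
  proof -
    have sk: "A$j$i = - A$i$j" for i j
      using arg_cong[OF A(2), of "\<lambda>M. M$i$j"] by (simp add: transpose_def)
    show "A$1$1 = 0" "A$2$2 = 0" "A$3$3 = 0" "A$1$2 = - A$2$1" "A$2$3 = - A$3$2" "A$3$1 = - A$1$3"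
      using sk[of 1 1] sk[of 2 2] sk[of 3 3] sk[of 2 1] sk[of 3 2] sk[of 1 3] by linarith+
  qed
  define w :: "real^4" where
    "w = (\<chi> i. if i = 1 then 0 else if i = 2 then A$3$2 / 2
               else if i = 3 then A$1$3 / 2 else A$2$1 / 2)"
  define q where "q t = axis 1 1 + t *\<^sub>R w" for t
  have rot: "rotq (q t) = mat 1 + t *\<^sub>R A + t^2 *\<^sub>R rotq w" for t
    unfolding vec_eq_iff forall_3 rotq_def Let_def q_def w_def
    by (simp add: axis_def mat_def skew power2_eq_square algebra_simps)
  have qq: "q t \<bullet> q t = 1 + t^2 * (w \<bullet> w)" for t
    by (simp add: q_def w_def inner_vec_def sum_4 axis_def power2_eq_square algebra_simps)
  have pos: "1 + t^2 * (w \<bullet> w) > 0" for t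
    by (intro add_pos_nonneg mult_nonneg_nonneg) auto
  define \<gamma> where "\<gamma> t = R ** ((1 / (q t \<bullet> q t)) *\<^sub>R rotq (q t))" for t
  have \<gamma>: "\<gamma> t = (1 / (1 + t^2 * (w \<bullet> w))) *\<^sub>R (R + t *\<^sub>R X + t^2 *\<^sub>R (R ** rotq w))" for t
    by (simp add: \<gamma>_def rot qq matrix_mult_scaleR matrix_add_ldistrib A(1))
  show thesis
  proof (rule that)
    show "\<gamma> t \<in> SO3" for t
    proof -
      have "q t \<noteq> 0" using pos[of t] qq[of t] by auto
      then show ?thesis unfolding \<gamma>_def using R by (intro SO3_mult rotq_normalized_in_SO3)
    qed
    show "\<gamma> 0 = R" by (simp add: \<gamma>)
    have "((\<lambda>t. (1 / (1 + t^2 * (w \<bullet> w))) *\<^sub>R (R + t *\<^sub>R X + t^2 *\<^sub>R (R ** rotq w)))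
        has_vector_derivative X) (at 0)"
      by (rule derivative_eq_intros refl | simp)+
    then show "(\<gamma> has_vector_derivative X) (at 0)" by (simp add: \<gamma>[abs_def])
  qed
qed

lemma SO3_derivative_unique:
  fixes f :: "mat3 \<Rightarrow> real"
  assumes R: "R \<in> SO3" and X: "X \<in> tangent_SO3 R"
    and f: "(f has_derivative f') (at R within SO3)" "(f has_derivative f'') (at R within SO3)"
  shows "f' X = f'' X"
proof -
  obtain \<gamma> :: "real \<Rightarrow> mat3" where
    \<gamma>: "\<And>t. \<gamma> t \<in> SO3" "\<gamma> 0 = R" "(\<gamma> has_vector_derivative X) (at 0)"
    using tangent_curve[OF R X] by metis
  have d: "((\<lambda>t. f (\<gamma> t)) has_derivative (\<lambda>t. k (t *\<^sub>R X))) (at 0)"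
    if "(f has_derivative k) (at R within SO3)" for k
  proof (rule has_derivative_in_compose[OF \<gamma>(3)[unfolded has_vector_derivative_def]])
    show "(f has_derivative k) (at (\<gamma> 0) within range \<gamma>)"
      using that \<gamma> by (auto intro: has_derivative_subset)
  qed
  have "(\<lambda>t. f' (t *\<^sub>R X)) = (\<lambda>t. f'' (t *\<^sub>R X))"
    by (rule has_derivative_unique[OF d[OF f(1)] d[OF f(2)]])
  from fun_cong[OF this, of 1] show ?thesis by simp
qed

text \<open>
  Curves in the rotation group determine the derivative on tangent vectors, so the description in the
  definition of \<open>grad_SO3\<close> is satisfied by at most one vector.
\<close>

lemma grad_SO3_eqI:
  assumes R: "R \<in> SO3" and G: "G \<in> tangent_SO3 R"
    and f: "(f has_derivative f') (at R within SO3)"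
    and m: "\<And>X. X \<in> tangent_SO3 R \<Longrightarrow> f' X = metric_SO3 R G X"
  shows "grad_SO3 f R = G"
  unfolding grad_SO3_def
proof (rule the_equality)
  show "G \<in> tangent_SO3 R \<and> (\<exists>f'. (f has_derivative f') (at R within SO3) \<and>
      (\<forall>X\<in>tangent_SO3 R. f' X = metric_SO3 R G X))"
    using G f m by blast
next
  fix G' assume "G' \<in> tangent_SO3 R \<and> (\<exists>f'. (f has_derivative f') (at R within SO3) \<and>
      (\<forall>X\<in>tangent_SO3 R. f' X = metric_SO3 R G' X))"
  then obtain f'' where G': "G' \<in> tangent_SO3 R" and f'': "(f has_derivative f'') (at R within SO3)"
    "\<And>X. X \<in> tangent_SO3 R \<Longrightarrow> f'' X = metric_SO3 R G' X" by blast
  obtain B B' where B: "G = R ** B" "transpose B = - B" "G' = R ** B'" "transpose B' = - B'"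
    using G G' by (auto simp: tangent_SO3_def)
  let ?X = "R ** (B - B')"
  have "transpose (B - B') = - (B - B')"
    using B by (simp add: transpose_linear)
  then have X: "?X \<in> tangent_SO3 R" by (auto simp: tangent_SO3_def)
  have RR: "transpose R ** (R ** M) = M" for M
    by (simp add: matrix_mul_assoc SO3_orth[OF R])
  have "metric_SO3 R G ?X = metric_SO3 R G' ?X"
    using SO3_derivative_unique[OF R X f f''(1)] m[OF X] f''(2)[OF X] by simp
  then have "B \<bullet> (B - B') = B' \<bullet> (B - B')"
    by (simp add: metric_SO3_def B RR)
  then have "(B - B') \<bullet> (B - B') = 0" by (simp add: inner_diff_left)
  then show "G' = G" using B by simp
qed

text \<open>
  Although \<open>arccos\<close> is not differentiable at \<open>1\<close>, its square has a one-sided derivative there. Hence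
  the kernel is differentiable on the diagonal; the value \<open>h 0 = g' 0\<close> comes from this derivative.
\<close>

lemma arccos_squared_has_derivative:
  fixes y :: real
  assumes "-1 < y" "y \<le> 1"
  shows "((\<lambda>y. (arccos y)\<^sup>2) has_real_derivative
     (if y = 1 then - 2 else - 2 * (arccos y / sin (arccos y)))) (at y within {-1..1})"
proof (cases "y = 1")
  case False
  then have y: "-1 < y" "y < 1" using assms by auto
  have s: "sqrt (1 - y\<^sup>2) = sin (arccos y)"
    using y by (simp add: sin_arccos)
  have "((\<lambda>y. (arccos y)\<^sup>2) has_real_derivative
      2 * arccos y * inverse (- sqrt (1 - y\<^sup>2))) (at y)"
    using DERIV_power[OF DERIV_arccos[OF y], of 2] by (simp add: numeral_2_eq_2 mult_ac)
  then show ?thesis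
    using False by (auto simp: s field_simps intro: has_field_derivative_at_within)
next
  case True
  \<comment> \<open>The difference quotient at \<open>cos \<theta>\<close>, rewritten with \<open>1 - cos \<theta> = 2 (sin (\<theta>/2))\<^sup>2\<close>.\<close>
  define F :: "real \<Rightarrow> real" where "F \<theta> = - 2 * (inverse (sin (\<theta>/2) / (\<theta>/2)))\<^sup>2" for \<theta>
  have "((\<lambda>\<theta>. sin (\<theta>/2) / (\<theta>/2)) \<longlongrightarrow> (1::real)) (at 0)"
    by (rule filterlim_compose[OF sinc_at_0])
      (auto simp: filterlim_at eventually_at_filter intro!: tendsto_eq_intros)
  then have F: "(F \<longlongrightarrow> -2) (at 0)"
    unfolding F_def using tendsto_mult[OF tendsto_const[of "-2"] tendsto_power[OF tendsto_inverse, of _ 1 _ 2]] by fastforce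
  have "(arccos \<longlongrightarrow> arccos 1) (at 1 within {-1..1})"
    using continuous_on_arccos' unfolding continuous_on_def by (rule bspec) simp
  moreover have "eventually (\<lambda>y. arccos y \<noteq> 0) (at 1 within {-1..1})"
    unfolding eventually_at_filter
    using arccos_eq_iff[of _ 1] by (intro always_eventually allI impI) auto
  ultimately have "filterlim arccos (at 0) (at 1 within {-1..1})"
    by (simp add: filterlim_at)
  then have "((\<lambda>y. F (arccos y)) \<longlongrightarrow> -2) (at 1 within {-1..1})"
    by (rule filterlim_compose[OF F])
  moreover have "F (arccos z) = ((arccos z)\<^sup>2 - (arccos 1)\<^sup>2) / (z - 1)" if z: "z \<in> {-1..1}" for z
  proof -
    have eq: "z - 1 = - 2 * (sin (arccos z / 2))\<^sup>2"
      using z cos_double_sin[of "arccos z / 2"] by (simp add: cos_arccos)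
    show ?thesis unfolding F_def eq by (simp add: power_divide)
  qed
  then have "eventually (\<lambda>z. F (arccos z) = ((arccos z)\<^sup>2 - (arccos 1)\<^sup>2) / (z - 1)) (at 1 within {-1..1})"
    unfolding eventually_at_filter by (intro always_eventually) blast
  ultimately have "((\<lambda>z. ((arccos z)\<^sup>2 - (arccos 1)\<^sup>2) / (z - 1)) \<longlongrightarrow> -2) (at 1 within {-1..1})"
    by (rule Lim_transform_eventually)
  then show ?thesis using True by (simp add: has_field_derivative_iff)
qed

lemma kernel_profile_has_derivative:
  assumes y: "-1 < y" "y \<le> 1"
    and g: "\<And>s. s \<ge> 0 \<Longrightarrow> (g has_real_derivative g' s) (at s within {0..})"
  shows "((\<lambda>y. g ((arccos y)\<^sup>2)) has_real_derivative - 2 * h_fun g' (arccos y)) (at y within {-1..1})"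
proof -
  have *: "(g has_real_derivative g' ((arccos y)\<^sup>2)) (at ((arccos y)\<^sup>2) within (\<lambda>y. (arccos y)\<^sup>2) ` {-1..1})"
    by (rule DERIV_subset[OF g]) auto
  have "arccos y = 0 \<longleftrightarrow> y = 1"
    using y arccos_eq_iff[of y 1] by auto
  then show ?thesis
    using DERIV_image_chain[OF * arccos_squared_has_derivative[OF y]]
    by (simp add: h_fun_def o_def mult_ac split: if_splits)
qed

lemma drift_alt: "R \<in> SO3 \<Longrightarrow> drift R Q = R ** (transpose R ** Q - transpose Q ** R)"
  by (simp add: drift_def matrix_mult_diff matrix_mul_assoc SO3_orth)

lemma grad_kernel:
  assumes R: "R \<in> SO3" and Q: "Q \<in> SO3" and RQ: "R \<bullet> Q > -1"
    and K: "\<And>R. R \<in> SO3 \<Longrightarrow> K R Q = g ((geo_dist R Q)\<^sup>2)"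
    and g: "\<And>s. s \<ge> 0 \<Longrightarrow> (g has_real_derivative g' s) (at s within {0..})"
  shows "grad_SO3 (\<lambda>R'. K R' Q) R = - (h_fun g' (geo_dist R Q) *\<^sub>R drift R Q)"
proof (rule grad_SO3_eqI[OF R])
  let ?h = "h_fun g' (geo_dist R Q)" let ?B = "transpose R ** Q - transpose Q ** R"
  have skew: "transpose ?B = - ?B"
    by (simp add: transpose_linear matrix_transpose_mul)
  have eq: "- (?h *\<^sub>R drift R Q) = R ** (- (?h *\<^sub>R ?B))"
    using matrix_mult_scaleR(1)[of R "- ?h" ?B] by (simp add: drift_alt[OF R])
  show "- (?h *\<^sub>R drift R Q) \<in> tangent_SO3 R"
    unfolding tangent_SO3_def eq using skew
    by (intro CollectI exI[of _ "- (?h *\<^sub>R ?B)"]) (simp only: transpose_linear(2,3) skew scaleR_minus_right minus_minus)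
  have "((\<lambda>y. g ((arccos y)\<^sup>2)) has_derivative (*) (- 2 * ?h))
      (at ((R \<bullet> Q - 1) / 2) within {-1..1})"
    using kernel_profile_has_derivative[of "(R \<bullet> Q - 1) / 2" g g'] RQ SO3_inner_le[OF R Q] g
    by (simp add: has_field_derivative_def geo_dist_inner)
  then have 1: "((\<lambda>y. g ((arccos y)\<^sup>2)) has_derivative (*) (- 2 * ?h))
      (at ((R \<bullet> Q - 1) / 2) within (\<lambda>R'. (R' \<bullet> Q - 1) / 2) ` SO3)"
  proof (rule has_derivative_subset)
    show "(\<lambda>R'. (R' \<bullet> Q - 1) / 2) ` SO3 \<subseteq> {-1..1}"
      using SO3_inner_ge[OF _ Q] SO3_inner_le[OF _ Q] by force
  qed
  have 2: "((\<lambda>R'. (R' \<bullet> Q - 1) / 2) has_derivative (\<lambda>X. (X \<bullet> Q) / 2)) (at R within SO3)"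
    by (auto intro!: derivative_eq_intros)
  have "((\<lambda>R'. g ((arccos ((R' \<bullet> Q - 1) / 2))\<^sup>2)) has_derivative (\<lambda>X. - ?h * (X \<bullet> Q))) (at R within SO3)"
    using has_derivative_in_compose[OF 2 1] by simp
  then show "((\<lambda>R'. K R' Q) has_derivative (\<lambda>X. - ?h * (X \<bullet> Q))) (at R within SO3)"
    by (rule has_derivative_transform[OF R, rotated]) (simp add: K geo_dist_inner)
  show "- ?h * (X \<bullet> Q) = metric_SO3 R (- (?h *\<^sub>R drift R Q)) X" if X: "X \<in> tangent_SO3 R" for X
  proof -
    obtain A where A: "X = R ** A" "transpose A = - A" using X by (auto simp: tangent_SO3_def)
    have RR: "transpose R ** (R ** M) = M" for M
      by (simp add: matrix_mul_assoc SO3_orth[OF R])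
    have "(transpose Q ** R) \<bullet> A = (transpose R ** Q) \<bullet> transpose A"
      using inner_transpose[of "transpose R ** Q" "transpose A"] by (simp add: matrix_transpose_mul)
    then have "?B \<bullet> A = 2 * ((transpose R ** Q) \<bullet> A)"
      by (simp add: inner_diff_left A(2))
    moreover have "X \<bullet> Q = (transpose R ** Q) \<bullet> A"
      unfolding A(1) inner_transpose_mult[of R A Q] by (rule inner_commute)
    moreover have "metric_SO3 R (- (?h *\<^sub>R drift R Q)) X = 1/2 * (- ?h * (?B \<bullet> A))"
      unfolding metric_SO3_def eq A(1) RR by simp
    ultimately show ?thesis by simp
  qed
qed

section \<open>Growth of the infimum of a family of functions\<close>

text \<open>
  If each member grows at rate \<open>\<kappa>\<close> up to a multiple of its distance from the infimum, then the infimum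
  grows at rate \<open>\<kappa>\<close>. The infimum need not be attained; the proof uses explicit Euler steps of
  length \<open>\<tau> \<le> 1 / L\<close>. Up to an error quadratic in \<open>\<tau>\<close>, a member falls short of growth at rate \<open>\<kappa>\<close>
  over one step by at most \<open>L \<tau>\<close> times its distance from the infimum, hence by at most that distance. So the
  infimum loses only the quadratic error, and the sum of these errors vanishes as \<open>\<tau>\<close> tends to zero.
\<close>

lemma INF_family_growth:
  fixes y y' :: "'i \<Rightarrow> real \<Rightarrow> real"
  assumes I: "I \<noteq> {}" and ab: "0 \<le> a" "a \<le> b" and L: "L \<ge> 0"
    and der: "\<And>i t. i \<in> I \<Longrightarrow> t \<ge> 0 \<Longrightarrow> (y i has_real_derivative y' i t) (at t within {0..})"
    and bnd: "\<And>i t. i \<in> I \<Longrightarrow> t \<ge> 0 \<Longrightarrow> \<bar>y' i t\<bar> \<le> B"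
    and low: "\<And>i t. i \<in> I \<Longrightarrow> t \<ge> 0 \<Longrightarrow> l \<le> y i t"
    and ineq: "\<And>i t. i \<in> I \<Longrightarrow> a \<le> t \<Longrightarrow> t \<le> b \<Longrightarrow> y' i t \<ge> \<kappa> - L * (y i t - (INF j\<in>I. y j t))"
  shows "(INF i\<in>I. y i a) + \<kappa> * (b - a) \<le> (INF i\<in>I. y i b)"
proof -
  define m where "m t = (INF i\<in>I. y i t)" for t
  have bdd: "bdd_below ((\<lambda>i. y i t) ` I)" if "t \<ge> 0" for t
    using low[OF _ that] by (intro bdd_belowI[of _ l]) auto
  have m_le: "m t \<le> y i t" if "t \<ge> 0" "i \<in> I" for t i
    unfolding m_def by (rule cINF_lower[OF bdd]) (use that in auto)
  have m_ge: "c \<le> m t" if "\<And>i. i \<in> I \<Longrightarrow> c \<le> y i t" for c t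
    unfolding m_def using I that by (intro cINF_greatest) auto
  obtain i0 where "i0 \<in> I" using I by blast
  then have B: "B \<ge> 0" using bnd[of i0 0] by auto
  have mvt: "\<exists>\<xi>. s \<le> \<xi> \<and> \<xi> \<le> t \<and> y i t - y i s = (t - s) * y' i \<xi>"
    if "i \<in> I" "0 \<le> s" "s \<le> t" for i s t
  proof (cases "s = t")
    case False
    then have "s < t" using that by simp
    moreover have "(y i has_derivative (*) (y' i x)) (at x within {s..t})" if "s \<le> x" "x \<le> t" for x
      using DERIV_subset[OF der[OF \<open>i \<in> I\<close>], of x "{s..t}"] that \<open>0 \<le> s\<close>
      by (auto simp: has_field_derivative_def)
    ultimately obtain \<xi> where "\<xi> \<in> {s<..<t}" "y i t - y i s = y' i \<xi> * (t - s)"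
      using mvt_simple[of s t "y i" "\<lambda>x. (*) (y' i x)"] by auto
    then show ?thesis by (intro exI[of _ \<xi>]) auto
  qed auto
  have lip: "\<bar>y i t - y i s\<bar> \<le> B * (t - s)" if i: "i \<in> I" and st: "0 \<le> s" "s \<le> t" for i s t
  proof -
    obtain \<xi> where "s \<le> \<xi>" "\<xi> \<le> t" "y i t - y i s = (t - s) * y' i \<xi>" using mvt[OF i st] by blast
    moreover have "\<bar>y' i \<xi>\<bar> \<le> B" using bnd[OF i, of \<xi>] st \<open>s \<le> \<xi>\<close> by simp
    ultimately show ?thesis using st by (simp add: abs_mult mult_left_mono mult.commute[of B])
  qed
  have step: "m s + \<kappa> * \<tau> - 2 * L * B * \<tau>\<^sup>2 \<le> m (s + \<tau>)"
    if st: "a \<le> s" "s + \<tau> \<le> b" "0 \<le> \<tau>" "L * \<tau> \<le> 1" for s \<tau>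
  proof (rule m_ge)
    fix i assume i: "i \<in> I"
    obtain \<xi> where \<xi>: "s \<le> \<xi>" "\<xi> \<le> s + \<tau>" "y i (s + \<tau>) - y i s = \<tau> * y' i \<xi>"
      using mvt[OF i, of s "s + \<tau>"] st ab by auto
    have "0 \<le> s" using st ab by simp
    have 1: "y i \<xi> \<le> y i s + B * \<tau>"
    proof -
      have "B * (\<xi> - s) \<le> B * \<tau>" using \<xi> B by (intro mult_left_mono) auto
      then show ?thesis using lip[OF i \<open>0 \<le> s\<close> \<xi>(1)] by linarith
    qed
    have 2: "m s - B * \<tau> \<le> m \<xi>"
    proof (rule m_ge)
      fix j assume j: "j \<in> I"
      have "B * (\<xi> - s) \<le> B * \<tau>" using \<xi> B by (intro mult_left_mono) auto
      then show "m s - B * \<tau> \<le> y j \<xi>" using lip[OF j \<open>0 \<le> s\<close> \<xi>(1)] m_le[OF \<open>0 \<le> s\<close> j] by linarith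
    qed
    have "y' i \<xi> \<ge> \<kappa> - L * (y i \<xi> - m \<xi>)"
      using ineq[OF i, of \<xi>] \<xi> st unfolding m_def by simp
    moreover have "L * (y i \<xi> - m \<xi>) \<le> L * (y i s - m s + 2 * B * \<tau>)"
      using 1 2 L by (intro mult_left_mono) auto
    ultimately have "y' i \<xi> \<ge> \<kappa> - L * (y i s - m s + 2 * B * \<tau>)" by linarith
    then have "\<tau> * y' i \<xi> \<ge> \<tau> * (\<kappa> - L * (y i s - m s + 2 * B * \<tau>))"
      using st by (intro mult_left_mono) auto
    moreover have "(L * \<tau>) * (y i s - m s) \<le> 1 * (y i s - m s)"
      using st m_le[OF \<open>0 \<le> s\<close> i] by (intro mult_right_mono) auto
    ultimately show "m s + \<kappa> * \<tau> - 2 * L * B * \<tau>\<^sup>2 \<le> y i (s + \<tau>)"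
      using \<xi>(3) by (simp add: algebra_simps power2_eq_square)
  qed
  define d where "d = b - a"
  have d: "d \<ge> 0" using ab by (simp add: d_def)
  have N: "m a + \<kappa> * d - 2 * L * B * d\<^sup>2 / real N \<le> m b" if N: "N > 0" "L * d \<le> real N" for N :: nat
  proof -
    define \<tau> where "\<tau> = d / real N"
    have \<tau>: "real N * \<tau> = d" "0 \<le> \<tau>" "L * \<tau> \<le> 1"
      using N d by (auto simp: \<tau>_def field_simps)
    have Suc_mult: "real (Suc k) * x = real k * x + x" for k x
      by (simp add: algebra_simps)
    have k: "m a + real k * (\<kappa> * \<tau> - 2 * L * B * \<tau>\<^sup>2) \<le> m (a + real k * \<tau>)" if "k \<le> N" for k
      using that
    proof (induction k)
      case (Suc k)
      have "real (Suc k) * \<tau> \<le> real N * \<tau>" using Suc.prems \<tau> by (intro mult_right_mono) auto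
      then have "a + real k * \<tau> + \<tau> \<le> b" unfolding Suc_mult \<tau>(1) d_def by linarith
      moreover have "a \<le> a + real k * \<tau>" using \<tau> by simp
      ultimately have "m (a + real k * \<tau>) + \<kappa> * \<tau> - 2 * L * B * \<tau>\<^sup>2 \<le> m (a + real k * \<tau> + \<tau>)"
        using \<tau> by (intro step) auto
      moreover have "m a + real k * (\<kappa> * \<tau> - 2 * L * B * \<tau>\<^sup>2) \<le> m (a + real k * \<tau>)"
        using Suc by simp
      ultimately show ?case unfolding Suc_mult add.assoc by linarith
    qed simp
    have "real N * (\<kappa> * \<tau> - 2 * L * B * \<tau>\<^sup>2) = \<kappa> * d - 2 * L * B * d\<^sup>2 / real N"
      using N by (simp add: \<tau>_def field_simps power2_eq_square)
    moreover have "a + real N * \<tau> = b" using \<tau> by (simp add: d_def)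
    ultimately show ?thesis using k[OF order_refl] by simp
  qed
  have "(\<lambda>N. m a + \<kappa> * d - (2 * L * B * d\<^sup>2) * (1 / real N)) \<longlonglongrightarrow> m a + \<kappa> * d - (2 * L * B * d\<^sup>2) * 0"
    by (intro tendsto_intros lim_1_over_n)
  moreover have "m a + \<kappa> * d - (2 * L * B * d\<^sup>2) * (1 / real n) \<le> m b" if "n \<ge> max 1 (nat \<lceil>L * d\<rceil>)" for n
    using N[of n] that by (simp add: nat_le_iff ceiling_le_iff)
  ultimately have "m a + \<kappa> * d - (2 * L * B * d\<^sup>2) * 0 \<le> m b"
    using LIMSEQ_le_const2 by blast
  then have "m a + \<kappa> * d \<le> m b" by simp
  then show ?thesis unfolding m_def d_def .
qed

section \<open>Concentration of the flow\<close>

text \<open>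
  The aggregation flow in Lagrangian form: the particles are labelled by the points of a probability
  space \<open>\<mu>\<close>, and \<open>x t i\<close> is the position at time \<open>t\<close> of the particle with label \<open>i\<close>. No
  regularity in the label is needed except measurability.
\<close>

locale aggregation_flow = prob_space \<mu> for \<mu> :: "'i measure" +
  fixes \<epsilon> :: real and h :: "real \<Rightarrow> real" and x :: "real \<Rightarrow> 'i \<Rightarrow> mat3"
  assumes eps: "0 < \<epsilon>" "\<epsilon> < pi/2"
    and h_mono: "mono_on {0..<pi} h"
    and h_nonneg: "h 0 \<ge> 0"
    and h_pos: "\<And>s. 0 < s \<Longrightarrow> s < pi \<Longrightarrow> h s > 0"
    and in_cap: "\<And>t i. t \<ge> 0 \<Longrightarrow> i \<in> space \<mu> \<Longrightarrow> x t i \<in> geo_ball (pi/2 - \<epsilon>)"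
    and measurable_flow: "\<And>t. t \<ge> 0 \<Longrightarrow> x t \<in> borel_measurable \<mu>"
    and flow: "\<And>t i. t \<ge> 0 \<Longrightarrow> i \<in> space \<mu> \<Longrightarrow>
        ((\<lambda>\<tau>. x \<tau> i) has_vector_derivative
           (LINT j|\<mu>. h (geo_dist (x t i) (x t j)) *\<^sub>R drift (x t i) (x t j))) (at t within {0..})"
begin

abbreviation cap :: "mat3 set" where "cap \<equiv> geo_ball (pi/2 - \<epsilon>)"

text \<open>
  The velocity at time \<open>t\<close> and position \<open>R\<close>.
\<close>

definition vel :: "real \<Rightarrow> mat3 \<Rightarrow> mat3" where
  "vel t R = (LINT j|\<mu>. h (geo_dist R (x t j)) *\<^sub>R drift R (x t j))"

text \<open>
  An upper bound of \<open>h\<close> on the distances that occur in \<open>cap\<close>.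
\<close>

definition hmax :: real where "hmax = h (pi - 2 * \<epsilon>)"

lemma cap_SO3: "R \<in> cap \<Longrightarrow> R \<in> SO3"
  by (simp add: geo_ball_def)

lemma sin_eps: "0 < sin \<epsilon>"
  using eps by (intro sin_gt_zero) auto

lemma h_ge_0: "0 \<le> s \<Longrightarrow> s < pi \<Longrightarrow> 0 \<le> h s"
  using h_nonneg h_pos[of s] by (cases "s = 0") auto

lemma hmax_nonneg: "0 \<le> hmax"
  unfolding hmax_def using eps by (intro h_ge_0) auto

lemmas cap_coordinates = geo_ball_coordinates[OF eps]
lemmas cap_geo_dist = geo_ball_geo_dist[OF eps]

lemma cap_h:
  assumes "R \<in> cap" "S \<in> cap"
  shows "0 \<le> h (geo_dist R S)" "h (geo_dist R S) \<le> hmax"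
proof -
  show "0 \<le> h (geo_dist R S)" using cap_geo_dist[OF assms] eps by (intro h_ge_0) auto
  show "h (geo_dist R S) \<le> hmax" unfolding hmax_def
    using cap_geo_dist[OF assms] eps by (intro mono_onD[OF h_mono]) auto
qed

lemma interaction_bound:
  assumes "R \<in> cap" "S \<in> cap"
  shows "norm (h (geo_dist R S) *\<^sub>R drift R S) \<le> 4 * hmax"
proof -
  have "norm (h (geo_dist R S) *\<^sub>R drift R S) \<le> hmax * 4"
    unfolding norm_scaleR using cap_h[OF assms] norm_drift_le[of R S] assms
    by (intro mult_mono) (auto simp: cap_SO3)
  then show ?thesis by simp
qed

lemma integrable_interaction:
  assumes t: "t \<ge> 0" and R: "R \<in> cap"
  shows "integrable \<mu> (\<lambda>j. h (geo_dist R (x t j)) *\<^sub>R drift R (x t j))"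
proof (rule integrable_const_bound)
  show "AE j in \<mu>. norm (h (geo_dist R (x t j)) *\<^sub>R drift R (x t j)) \<le> 4 * hmax"
    using in_cap[OF t] R by (intro AE_I2 interaction_bound)
  have "x t \<in> \<mu> \<rightarrow>\<^sub>M restrict_space borel cap"
    using in_cap[OF t] measurable_flow[OF t] by (intro measurable_restrict_space2) auto
  moreover have "(\<lambda>Q. h (geo_dist R Q) *\<^sub>R drift R Q) \<in> borel_measurable (restrict_space borel cap)"
    using cap_geo_dist[OF R] R eps by (intro interaction_measurable h_mono) (force simp: cap_SO3)+
  ultimately show "(\<lambda>j. h (geo_dist R (x t j)) *\<^sub>R drift R (x t j)) \<in> borel_measurable \<mu>"
    by (rule measurable_compose)
qed

lemma vel_bound:
  assumes "t \<ge> 0" "R \<in> cap" shows "norm (vel t R) \<le> 4 * hmax"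
proof -
  let ?f = "\<lambda>j. h (geo_dist R (x t j)) *\<^sub>R drift R (x t j)"
  have "(LINT j|\<mu>. norm (?f j)) \<le> 4 * hmax"
    using integrable_norm[OF integrable_interaction[OF assms]] interaction_bound in_cap assms
    by (intro integral_le_const) (auto simp del: norm_scaleR)
  then show ?thesis unfolding vel_def
    using integral_norm_bound[of \<mu> ?f] by linarith
qed

lemma inner_vel:
  assumes "t \<ge> 0" "R \<in> cap"
  shows "C \<bullet> vel t R = (LINT j|\<mu>. h (geo_dist R (x t j)) * (C \<bullet> drift R (x t j)))"
    "integrable \<mu> (\<lambda>j. h (geo_dist R (x t j)) * (C \<bullet> drift R (x t j)))"
  using integral_inner_right[of C \<mu> "\<lambda>j. h (geo_dist R (x t j)) *\<^sub>R drift R (x t j)"]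
    integrable_inner_right[of C \<mu> "\<lambda>j. h (geo_dist R (x t j)) *\<^sub>R drift R (x t j)"]
    integrable_interaction[OF assms]
  by (simp_all add: vel_def)

text \<open>
  The quantitative form of the sign of \<open>C \<bullet> drift R S\<close>: if \<open>R\<close> and \<open>S\<close> both have inner product at least
  \<open>m\<close> with \<open>C\<close>, then the rate is nonnegative up to the excess of \<open>C \<bullet> R\<close> over \<open>m\<close>. The first term on
  the right is the gain for \<open>S \<noteq> R\<close>.
\<close>

lemma inner_drift_ge:
  assumes cap: "C \<in> cap" "R \<in> cap" "S \<in> cap" and m: "m \<le> C \<bullet> R" "m \<le> C \<bullet> S"
  shows "C \<bullet> drift R S \<ge>
    16 * (quat_lift C \<bullet> quat_lift R)\<^sup>2 * (quat_lift R \<bullet> quat_lift S) * (1 - quat_lift R \<bullet> quat_lift S) - 4 * (C \<bullet> R - m)"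
proof -
  define a b w where "a = quat_lift C \<bullet> quat_lift R" and "b = quat_lift R \<bullet> quat_lift S" and "w = quat_lift C \<bullet> quat_lift S"
  have a: "0 < a" "a \<le> 1" "C \<bullet> R = 4 * a\<^sup>2 - 1" and b: "0 < b" "b \<le> 1" and w: "0 < w" "C \<bullet> S = 4 * w\<^sup>2 - 1"
    using cap_coordinates cap by (auto simp: a_def b_def w_def)
  have eq: "C \<bullet> drift R S = 16 * a * b * (w - a * b)"
    using inner_drift[of "quat_lift C" "quat_lift R" "quat_lift S"] geo_ball_lift(2,3)[OF eps] cap
    by (simp add: a_def b_def w_def)
  have "16 * (a * b) * (w - a) \<ge> - 4 * (C \<bullet> R - m)"
  proof (cases "w \<ge> a")
    case True
    then have "16 * (a * b) * (w - a) \<ge> 0" using a b by simp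
    moreover have "- 4 * (C \<bullet> R - m) \<le> 0" using m by simp
    ultimately show ?thesis by (rule order_trans[rotated])
  next
    case False
    have "a * b \<le> a * 1" using a b by (intro mult_left_mono) auto
    then have "a * b \<le> w + a" using w by simp
    then have "(a * b) * (a - w) \<le> (w + a) * (a - w)" using False by (intro mult_right_mono) auto
    also have "\<dots> = a\<^sup>2 - w\<^sup>2" by (simp add: power2_eq_square algebra_simps)
    finally have "16 * (a * b) * (w - a) \<ge> - 4 * (4 * a\<^sup>2 - 4 * w\<^sup>2)" by (simp add: algebra_simps)
    moreover have "- 4 * (C \<bullet> R - m) \<le> - 4 * (4 * a\<^sup>2 - 4 * w\<^sup>2)" using m a w by simp
    ultimately show ?thesis by (rule order_trans[rotated])
  qed
  then show ?thesis unfolding eq a_def[symmetric] b_def[symmetric]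
    by (simp add: algebra_simps power2_eq_square)
qed

lemma scaled_inner_drift_ge:
  assumes cap: "C \<in> cap" "R \<in> cap" "S \<in> cap" and m: "m \<le> C \<bullet> R" "m \<le> C \<bullet> S"
  shows "h (geo_dist R S) * (C \<bullet> drift R S) \<ge>
    h (geo_dist R S) * (16 * (quat_lift C \<bullet> quat_lift R)\<^sup>2 * (quat_lift R \<bullet> quat_lift S) * (1 - quat_lift R \<bullet> quat_lift S))
      - 4 * hmax * (C \<bullet> R - m)"
proof -
  note h = cap_h[OF cap(2,3)]
  have "h (geo_dist R S) * (4 * (C \<bullet> R - m)) \<le> hmax * (4 * (C \<bullet> R - m))"
    using h m by (intro mult_right_mono) auto
  moreover have "h (geo_dist R S) * (C \<bullet> drift R S) \<ge> h (geo_dist R S) *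
     (16 * (quat_lift C \<bullet> quat_lift R)\<^sup>2 * (quat_lift R \<bullet> quat_lift S) * (1 - quat_lift R \<bullet> quat_lift S) - 4 * (C \<bullet> R - m))"
    using inner_drift_ge[OF assms] h by (intro mult_left_mono) auto
  ultimately show ?thesis by (simp add: algebra_simps)
qed

lemma flow': "t \<ge> 0 \<Longrightarrow> i \<in> space \<mu> \<Longrightarrow>
    ((\<lambda>\<tau>. x \<tau> i) has_vector_derivative vel t (x t i)) (at t within {0..})"
  using flow by (simp add: vel_def)

text \<open>
  The ball \<open>{Q. c \<le> C \<bullet> Q}\<close> is forward invariant for every centre in \<open>cap\<close>; the growth lemma is applied
  with \<open>\<kappa> = 0\<close> to the functions \<open>C \<bullet> x t i\<close>.
\<close>

lemma ball_invariance:
  assumes C: "C \<in> cap" and st: "0 \<le> s" "s \<le> t"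
    and c: "\<And>i. i \<in> space \<mu> \<Longrightarrow> c \<le> C \<bullet> x s i" and i: "i \<in> space \<mu>"
  shows "c \<le> C \<bullet> x t i"
proof -
  have low: "-1 \<le> C \<bullet> x \<tau> j" if "j \<in> space \<mu>" "\<tau> \<ge> 0" for \<tau> j
    using SO3_inner_ge[of C "x \<tau> j"] C in_cap that by (auto simp: cap_SO3)
  have bdd: "bdd_below ((\<lambda>j. C \<bullet> x \<tau> j) ` space \<mu>)" if "\<tau> \<ge> 0" for \<tau>
    using low that by (intro bdd_belowI[of _ "-1"]) auto
  have "(INF j\<in>space \<mu>. C \<bullet> x s j) + 0 * (t - s) \<le> (INF j\<in>space \<mu>. C \<bullet> x t j)"
  proof (rule INF_family_growth[where y' = "\<lambda>j \<tau>. C \<bullet> vel \<tau> (x \<tau> j)" and B = "norm C * (4 * hmax)"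
        and l = "-1" and L = "4 * hmax"])
    fix j \<tau> assume j: "j \<in> space \<mu>" and \<tau>: "(0::real) \<le> \<tau>"
    show "((\<lambda>\<tau>. C \<bullet> x \<tau> j) has_real_derivative C \<bullet> vel \<tau> (x \<tau> j)) (at \<tau> within {0..})"
      unfolding has_real_derivative_iff_has_vector_derivative
      by (rule bounded_linear.has_vector_derivative[OF bounded_linear_inner_right flow'[OF \<tau> j]])
    have "\<bar>C \<bullet> vel \<tau> (x \<tau> j)\<bar> \<le> norm C * norm (vel \<tau> (x \<tau> j))" by (rule Cauchy_Schwarz_ineq2)
    also have "\<dots> \<le> norm C * (4 * hmax)"
      using vel_bound[OF \<tau> in_cap[OF \<tau> j]] by (intro mult_left_mono) auto
    finally show "\<bar>C \<bullet> vel \<tau> (x \<tau> j)\<bar> \<le> norm C * (4 * hmax)" .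
    show "-1 \<le> C \<bullet> x \<tau> j" using low j \<tau> .
  next
    fix j \<tau> assume j: "j \<in> space \<mu>" and "s \<le> \<tau>"
    then have \<tau>: "0 \<le> \<tau>" using st by simp
    let ?m = "INF j\<in>space \<mu>. C \<bullet> x \<tau> j"
    have m: "?m \<le> C \<bullet> x \<tau> k" if "k \<in> space \<mu>" for k
      using bdd[OF \<tau>] that by (rule cINF_lower)
    note R = in_cap[OF \<tau> j]
    have "- (4 * hmax * (C \<bullet> x \<tau> j - ?m)) \<le> h (geo_dist (x \<tau> j) (x \<tau> k)) * (C \<bullet> drift (x \<tau> j) (x \<tau> k))"
      if k: "k \<in> space \<mu>" for k
    proof -
      note S = in_cap[OF \<tau> k]
      have "0 \<le> h (geo_dist (x \<tau> j) (x \<tau> k)) * (16 * (quat_lift C \<bullet> quat_lift (x \<tau> j))\<^sup>2 *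
          (quat_lift (x \<tau> j) \<bullet> quat_lift (x \<tau> k)) * (1 - quat_lift (x \<tau> j) \<bullet> quat_lift (x \<tau> k)))"
        using cap_h[OF R S] cap_coordinates[OF R S] by (intro mult_nonneg_nonneg) auto
      then show ?thesis using scaled_inner_drift_ge[OF C R S m[OF j] m[OF k]] by linarith
    qed
    then have "- (4 * hmax * (C \<bullet> x \<tau> j - ?m)) \<le> C \<bullet> vel \<tau> (x \<tau> j)"
      unfolding inner_vel(1)[OF \<tau> R] using inner_vel(2)[OF \<tau> R] by (intro integral_ge_const) auto
    then show "0 - 4 * hmax * (C \<bullet> x \<tau> j - ?m) \<le> C \<bullet> vel \<tau> (x \<tau> j)" by simp
  qed (use not_empty st hmax_nonneg in auto)
  moreover have "c \<le> (INF j\<in>space \<mu>. C \<bullet> x s j)"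
    using not_empty c by (intro cINF_greatest) auto
  moreover have "(INF j\<in>space \<mu>. C \<bullet> x t j) \<le> C \<bullet> x t i"
    using bdd[of t] i st by (intro cINF_lower) auto
  ultimately show ?thesis by simp
qed

text \<open>
  The infimum of the inner products of two particles. It measures the diameter: it is at most \<open>3\<close>, and
  a value near \<open>3\<close> means that all particles are close to each other.
\<close>

definition min_inner :: "real \<Rightarrow> real" where
  "min_inner t = (INF (i, j)\<in>space \<mu> \<times> space \<mu>. x t i \<bullet> x t j)"

lemma pair_inner_bounds:
  assumes "t \<ge> 0" "i \<in> space \<mu>" "j \<in> space \<mu>"
  shows "-1 \<le> x t i \<bullet> x t j" "x t i \<bullet> x t j \<le> 3"
  using SO3_inner_ge[of "x t i" "x t j"] SO3_inner_le[of "x t i" "x t j"] in_cap assms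
  by (auto simp: cap_SO3)

lemma min_inner_le:
  assumes "t \<ge> 0" "i \<in> space \<mu>" "j \<in> space \<mu>"
  shows "min_inner t \<le> x t i \<bullet> x t j"
proof -
  have "bdd_below ((\<lambda>(i, j). x t i \<bullet> x t j) ` (space \<mu> \<times> space \<mu>))"
    using pair_inner_bounds(1)[OF assms(1)] by (intro bdd_belowI[of _ "-1"]) auto
  then have "min_inner t \<le> (case (i, j) of (i, j) \<Rightarrow> x t i \<bullet> x t j)"
    unfolding min_inner_def using assms by (intro cINF_lower) auto
  then show ?thesis by simp
qed

text \<open>
  The two summands are the lower bounds of \<open>scaled_inner_drift_ge\<close> for the pull of \<open>S\<close> on \<open>R\<close> and
  on \<open>P\<close>. One of them is bounded below, since \<open>S\<close> cannot be close to both of the distant points \<open>P\<close> and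
  \<open>R\<close>.
\<close>

lemma pair_interaction_ge:
  assumes "c < 3"
  obtains \<kappa> where "\<kappa> > 0"
    "\<And>P R S. P \<in> cap \<Longrightarrow> R \<in> cap \<Longrightarrow> S \<in> cap \<Longrightarrow> P \<bullet> R \<le> c \<Longrightarrow>
      \<kappa> \<le> h (geo_dist R S) * (16 * (quat_lift P \<bullet> quat_lift R)\<^sup>2 * (quat_lift R \<bullet> quat_lift S) * (1 - quat_lift R \<bullet> quat_lift S))
        + h (geo_dist P S) * (16 * (quat_lift P \<bullet> quat_lift R)\<^sup>2 * (quat_lift P \<bullet> quat_lift S) * (1 - quat_lift P \<bullet> quat_lift S))"
proof -
  define c' where "c' = max c 0"
  have c': "0 \<le> c'" "c' < 3" "c \<le> c'" using assms by (auto simp: c'_def)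
  \<comment> \<open>\<open>\<alpha>\<close> bounds the inner product of the lifts of \<open>P\<close> and \<open>R\<close>; by Cauchy-Schwarz applied to \<open>s\<close> and
      \<open>p + q\<close>, the smaller one of the inner products of \<open>s\<close> with \<open>p\<close> and \<open>q\<close> is at most \<open>\<sigma> < 1\<close>.\<close>
  define \<alpha> where "\<alpha> = sqrt ((1 + c') / 4)"
  have "\<alpha>\<^sup>2 = (1 + c') / 4" using c' by (simp add: \<alpha>_def)
  then have \<alpha>: "0 < \<alpha>" "\<alpha> < 1" "4 * \<alpha>\<^sup>2 = 1 + c'" using c' by (auto simp: \<alpha>_def)
  define \<sigma> where "\<sigma> = sqrt ((1 + \<alpha>) / 2)"
  have \<sigma>: "0 < \<sigma>" "\<sigma> < 1" "\<sigma>\<^sup>2 = (1 + \<alpha>) / 2" using \<alpha> by (auto simp: \<sigma>_def)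
  define \<delta> where "\<delta> = arccos (2 * \<sigma>\<^sup>2 - 1)"
  have "-1 < 2 * \<sigma>\<^sup>2 - 1" "2 * \<sigma>\<^sup>2 - 1 < 1" using \<sigma> \<alpha> by auto
  then have \<delta>: "0 < \<delta>" "\<delta> < pi" "cos \<delta> = 2 * \<sigma>\<^sup>2 - 1"
    using arccos_lt_bounded[of "2 * \<sigma>\<^sup>2 - 1"] by (auto simp: \<delta>_def)
  have key: "h \<delta> * (16 * (sin \<epsilon>)\<^sup>2 * sin \<epsilon> * (1 - \<sigma>)) \<le>
      h (geo_dist R S) * (16 * a\<^sup>2 * (quat_lift R \<bullet> quat_lift S) * (1 - quat_lift R \<bullet> quat_lift S))"
    if cap: "R \<in> cap" "S \<in> cap" and le: "quat_lift R \<bullet> quat_lift S \<le> \<sigma>" and a: "sin \<epsilon> \<le> a" for R S a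
  proof -
    note w = cap_coordinates[OF cap]
    have "(quat_lift R \<bullet> quat_lift S)\<^sup>2 \<le> \<sigma>\<^sup>2" using le w by (intro power_mono) auto
    then have "\<not> geo_dist R S < \<delta>"
      using geo_dist_less_iff[of R S \<delta>] cap \<delta> w(4) by (auto simp: cap_SO3)
    then have "h \<delta> \<le> h (geo_dist R S)"
      using cap_geo_dist[OF cap] \<delta> eps by (intro mono_onD[OF h_mono]) auto
    moreover have "(sin \<epsilon>)\<^sup>2 \<le> a\<^sup>2" using sin_eps a by (intro power_mono) auto
    ultimately show ?thesis using sin_eps w le \<sigma> cap_h[OF cap] h_pos[of \<delta>] \<delta>
      by (intro mult_mono mult_nonneg_nonneg) auto
  qed
  show thesis
  proof (rule that)
    show "h \<delta> * (16 * (sin \<epsilon>)\<^sup>2 * sin \<epsilon> * (1 - \<sigma>)) > 0"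
      using h_pos[of \<delta>] \<delta> sin_eps \<sigma> by simp
    fix P R S assume cap: "P \<in> cap" "R \<in> cap" "S \<in> cap" and PR: "P \<bullet> R \<le> c"
    define p q s a where "p = quat_lift P" and "q = quat_lift R" and "s = quat_lift S" and "a = p \<bullet> q"
    have n: "norm p = 1" "norm q = 1" "norm s = 1"
      using geo_ball_lift(2)[OF eps] cap by (auto simp: p_def q_def s_def)
    have a: "sin \<epsilon> \<le> a" "0 < a" "P \<bullet> R = 4 * a\<^sup>2 - 1"
      using cap_coordinates[OF cap(1,2)] by (auto simp: a_def p_def q_def)
    have "a\<^sup>2 \<le> \<alpha>\<^sup>2" using a PR \<alpha> c' by linarith
    then have "a \<le> \<alpha>" by (rule power2_le_imp_le) (use \<alpha> in auto)
    have "(s \<bullet> (p + q))\<^sup>2 \<le> (p + q) \<bullet> (p + q)"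
      using Cauchy_Schwarz_ineq[of s "p + q"] n by (simp add: norm_eq_1)
    also have "\<dots> = 2 + 2 * a"
      using n by (simp add: a_def inner_add_left inner_add_right inner_commute norm_eq_1)
    also have "\<dots> \<le> (2 * \<sigma>)\<^sup>2" using \<open>a \<le> \<alpha>\<close> \<sigma> by (simp add: power_mult_distrib)
    finally have "s \<bullet> (p + q) \<le> 2 * \<sigma>" by (rule power2_le_imp_le) (use \<sigma> in auto)
    then have "p \<bullet> s + q \<bullet> s \<le> 2 * \<sigma>" by (simp add: inner_add_right inner_commute)
    then consider "q \<bullet> s \<le> \<sigma>" | "p \<bullet> s \<le> \<sigma>" by linarith
    then show "h \<delta> * (16 * (sin \<epsilon>)\<^sup>2 * sin \<epsilon> * (1 - \<sigma>)) \<le>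
        h (geo_dist R S) * (16 * (quat_lift P \<bullet> quat_lift R)\<^sup>2 * (quat_lift R \<bullet> quat_lift S) * (1 - quat_lift R \<bullet> quat_lift S))
        + h (geo_dist P S) * (16 * (quat_lift P \<bullet> quat_lift R)\<^sup>2 * (quat_lift P \<bullet> quat_lift S) * (1 - quat_lift P \<bullet> quat_lift S))"
      (is "_ \<le> ?X + ?Y")
    proof cases
      case 1
      have "0 \<le> ?Y" using cap_h[OF cap(1,3)] cap_coordinates[OF cap(1,3)]
        by (intro mult_nonneg_nonneg) auto
      then show ?thesis
        by (rule add_increasing2) (rule key[OF cap(2,3)], use 1 a in \<open>simp_all add: a_def p_def q_def s_def\<close>)
    next
      case 2
      have "0 \<le> ?X" using cap_h[OF cap(2,3)] cap_coordinates[OF cap(2,3)]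
        by (intro mult_nonneg_nonneg) auto
      then show ?thesis
        by (rule add_increasing) (rule key[OF cap(1,3)], use 2 a in \<open>simp_all add: a_def p_def q_def s_def\<close>)
    qed
  qed
qed

text \<open>
  As long as \<open>min_inner\<close> does not exceed \<open>c\<close>, it grows at a fixed rate; but it is bounded.
\<close>

lemma concentration:
  assumes "c < 3"
  shows "\<exists>t\<ge>0. min_inner t > c"
proof (rule ccontr)
  assume "\<not> (\<exists>t\<ge>0. min_inner t > c)"
  then have le_c: "min_inner t \<le> c" if "t \<ge> 0" for t using that by force
  \<comment> \<open>Pairs with inner product at most \<open>c + d\<close> attract each other at rate \<open>\<kappa>\<close>. All other pairs
      exceed the infimum by at least \<open>d\<close>, so for them the summand \<open>\<kappa> / d\<close> of \<open>L\<close> compensates \<open>\<kappa>\<close>.\<close>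
  define d where "d = (3 - c) / 2"
  have d: "d > 0" "c + d < 3" using assms by (auto simp: d_def field_simps)
  obtain \<kappa> where \<kappa>: "\<kappa> > 0"
    "\<And>P R S. P \<in> cap \<Longrightarrow> R \<in> cap \<Longrightarrow> S \<in> cap \<Longrightarrow> P \<bullet> R \<le> c + d \<Longrightarrow>
      \<kappa> \<le> h (geo_dist R S) * (16 * (quat_lift P \<bullet> quat_lift R)\<^sup>2 * (quat_lift R \<bullet> quat_lift S) * (1 - quat_lift R \<bullet> quat_lift S))
        + h (geo_dist P S) * (16 * (quat_lift P \<bullet> quat_lift R)\<^sup>2 * (quat_lift P \<bullet> quat_lift S) * (1 - quat_lift P \<bullet> quat_lift S))"
    using pair_interaction_ge[OF d(2)] by metis
  define L where "L = 8 * hmax + \<kappa> / d"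
  have L: "L \<ge> 0" "L \<ge> 8 * hmax" using hmax_nonneg \<kappa> d by (auto simp: L_def)
  \<comment> \<open>In the time \<open>b\<close> the infimum would grow by \<open>5\<close>, but it stays in the interval from \<open>-1\<close> to \<open>3\<close>.\<close>
  define b where "b = 5 / \<kappa>"
  have b: "b \<ge> 0" "\<kappa> * b = 5" using \<kappa> by (auto simp: b_def)
  let ?I = "space \<mu> \<times> space \<mu>"
  let ?y = "\<lambda>p t. case p of (i, j) \<Rightarrow> x t i \<bullet> x t j"
  let ?y' = "\<lambda>p t. case p of (i, j) \<Rightarrow> x t i \<bullet> vel t (x t j) + x t j \<bullet> vel t (x t i)"
  have min_inner_INF: "min_inner t = (INF p\<in>?I. ?y p t)" for t by (simp add: min_inner_def)
  have "(INF p\<in>?I. ?y p 0) + \<kappa> * (b - 0) \<le> (INF p\<in>?I. ?y p b)"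
  proof (rule INF_family_growth[where y' = ?y' and B = "2 * (2 * (4 * hmax))" and l = "-1" and L = L])
    fix p \<tau> assume "p \<in> ?I" and \<tau>: "(0::real) \<le> \<tau>"
    then obtain i j where p: "p = (i, j)" "i \<in> space \<mu>" "j \<in> space \<mu>" by auto
    have "((\<lambda>\<tau>. x \<tau> i \<bullet> x \<tau> j) has_vector_derivative
        x \<tau> i \<bullet> vel \<tau> (x \<tau> j) + vel \<tau> (x \<tau> i) \<bullet> x \<tau> j) (at \<tau> within {0..})"
      by (rule bounded_bilinear.has_vector_derivative[OF bounded_bilinear_inner flow' flow'])
        (use p \<tau> in auto)
    then show "(?y p has_real_derivative ?y' p \<tau>) (at \<tau> within {0..})"
      by (simp add: has_real_derivative_iff_has_vector_derivative p inner_commute)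
    have bd: "\<bar>x \<tau> i \<bullet> vel \<tau> (x \<tau> j)\<bar> \<le> 2 * (4 * hmax)" if "i \<in> space \<mu>" "j \<in> space \<mu>" for i j
    proof -
      have "norm (x \<tau> i) \<le> 2"
        using SO3_norm[of "x \<tau> i"] in_cap[OF \<tau> that(1)] real_sqrt_le_mono[of 3 4] by (simp add: cap_SO3)
      then have "norm (x \<tau> i) * norm (vel \<tau> (x \<tau> j)) \<le> 2 * (4 * hmax)"
        using vel_bound[OF \<tau> in_cap[OF \<tau> that(2)]] hmax_nonneg by (intro mult_mono) auto
      then show ?thesis using Cauchy_Schwarz_ineq2[of "x \<tau> i" "vel \<tau> (x \<tau> j)"] by linarith
    qed
    show "\<bar>?y' p \<tau>\<bar> \<le> 2 * (2 * (4 * hmax))"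
      using bd[of i j] bd[of j i] p by simp
    show "-1 \<le> ?y p \<tau>" using pair_inner_bounds(1)[OF \<tau> p(2,3)] p by simp
  next
    fix p \<tau> assume "p \<in> ?I" and \<tau>: "(0::real) \<le> \<tau>"
    then obtain i j where p: "p = (i, j)" "i \<in> space \<mu>" "j \<in> space \<mu>" by auto
    let ?P = "x \<tau> i" and ?R = "x \<tau> j"
    note P = in_cap[OF \<tau> p(2)] and R = in_cap[OF \<tau> p(3)]
    define y where "y = ?P \<bullet> ?R"
    let ?m = "min_inner \<tau>"
    have ym: "?m \<le> y" unfolding y_def using min_inner_le[OF \<tau> p(2,3)] .
    have pt: "\<kappa> - L * (y - ?m) \<le> h (geo_dist ?R (x \<tau> k)) * (?P \<bullet> drift ?R (x \<tau> k))
        + h (geo_dist ?P (x \<tau> k)) * (?R \<bullet> drift ?P (x \<tau> k))" if k: "k \<in> space \<mu>" for k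
    proof -
      note S = in_cap[OF \<tau> k]
      let ?X = "h (geo_dist ?R (x \<tau> k)) *
        (16 * (quat_lift ?P \<bullet> quat_lift ?R)\<^sup>2 * (quat_lift ?R \<bullet> quat_lift (x \<tau> k)) * (1 - quat_lift ?R \<bullet> quat_lift (x \<tau> k)))"
      let ?Y = "h (geo_dist ?P (x \<tau> k)) *
        (16 * (quat_lift ?P \<bullet> quat_lift ?R)\<^sup>2 * (quat_lift ?P \<bullet> quat_lift (x \<tau> k)) * (1 - quat_lift ?P \<bullet> quat_lift (x \<tau> k)))"
      have nn: "0 \<le> ?X" "0 \<le> ?Y"
        using cap_h[OF P S] cap_coordinates[OF P S] cap_h[OF R S] cap_coordinates[OF R S]
        by (intro mult_nonneg_nonneg; simp)+
      have "?X - 4 * hmax * (y - ?m) \<le> h (geo_dist ?R (x \<tau> k)) * (?P \<bullet> drift ?R (x \<tau> k))"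
        unfolding y_def using min_inner_le[OF \<tau>] p k by (intro scaled_inner_drift_ge[OF P R S]) auto
      moreover have "?Y - 4 * hmax * (y - ?m) \<le> h (geo_dist ?P (x \<tau> k)) * (?R \<bullet> drift ?P (x \<tau> k))"
        using scaled_inner_drift_ge[OF R P S, of ?m] min_inner_le[OF \<tau>] p k
        by (simp add: inner_commute y_def)
      moreover have "\<kappa> - L * (y - ?m) \<le> ?X + ?Y - 8 * hmax * (y - ?m)"
      proof (cases "y \<le> c + d")
        case True
        then have "\<kappa> \<le> ?X + ?Y" using \<kappa>(2)[OF P R S] by (simp add: y_def)
        moreover have "8 * hmax * (y - ?m) \<le> L * (y - ?m)" using L ym by (intro mult_right_mono) auto
        ultimately show ?thesis by linarith
      next
        case False
        then have "d \<le> y - ?m" using le_c[OF \<tau>] by simp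
        then have "\<kappa> / d * d \<le> \<kappa> / d * (y - ?m)" using \<kappa> d by (intro mult_left_mono) auto
        then have "\<kappa> \<le> \<kappa> / d * (y - ?m)" using d by simp
        then have "\<kappa> - L * (y - ?m) \<le> - (8 * hmax * (y - ?m))"
          unfolding L_def distrib_right by linarith
        then show ?thesis using nn by linarith
      qed
      ultimately show ?thesis by linarith
    qed
    have "\<kappa> - L * (y - ?m) \<le> (LINT k|\<mu>. h (geo_dist ?R (x \<tau> k)) * (?P \<bullet> drift ?R (x \<tau> k))
        + h (geo_dist ?P (x \<tau> k)) * (?R \<bullet> drift ?P (x \<tau> k)))"
      using inner_vel(2)[OF \<tau> R] inner_vel(2)[OF \<tau> P] pt by (intro integral_ge_const) auto
    also have "\<dots> = ?P \<bullet> vel \<tau> ?R + ?R \<bullet> vel \<tau> ?P"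
      using inner_vel[OF \<tau> R] inner_vel[OF \<tau> P] by simp
    finally show "\<kappa> - L * (?y p \<tau> - (INF p\<in>?I. ?y p \<tau>)) \<le> ?y' p \<tau>"
      unfolding min_inner_INF[symmetric] by (simp add: p y_def)
  qed (use not_empty b L in auto)
  then have "min_inner 0 + 5 \<le> min_inner b" using b by (simp add: min_inner_INF)
  moreover obtain i where i: "i \<in> space \<mu>" using not_empty by blast
  have "-1 \<le> min_inner 0" unfolding min_inner_INF
    using not_empty pair_inner_bounds(1)[of 0] by (intro cINF_greatest) auto
  moreover have "min_inner b \<le> 3" using min_inner_le[OF b(1) i i] pair_inner_bounds(2)[OF b(1) i i] by linarith
  ultimately show False by linarith
qed

theorem consensus:
  assumes c: "\<And>i. i \<in> space \<mu> \<Longrightarrow> c \<le> mat 1 \<bullet> x 0 i"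
  obtains P where "P \<in> SO3" "c \<le> mat 1 \<bullet> P"
    "\<And>e. e > 0 \<Longrightarrow> \<exists>T\<ge>0. \<forall>t\<ge>T. \<forall>i\<in>space \<mu>. dist (x t i) P \<le> e"
proof -
  obtain k where k: "k \<in> space \<mu>" using not_empty by blast
  have near: "\<exists>T\<ge>0. \<forall>t\<ge>T. \<forall>i\<in>space \<mu>. dist (x T k) (x t i) \<le> e" if e: "e > 0" for e
  proof -
    \<comment> \<open>The inner product \<open>3 - e\<^sup>2 / 2\<close> corresponds to the Frobenius distance \<open>e\<close>.\<close>
    obtain T where T: "T \<ge> 0" "min_inner T > 3 - e\<^sup>2 / 2" using concentration[of "3 - e\<^sup>2 / 2"] e by auto
    have "dist (x T k) (x t i) \<le> e" if t: "t \<ge> T" and i: "i \<in> space \<mu>" for t i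
    proof -
      have t0: "t \<ge> 0" using T t by simp
      note P = in_cap[OF T(1) k] and Q = in_cap[OF t0 i]
      have "3 - e\<^sup>2 / 2 \<le> x T k \<bullet> x t i"
      proof (rule ball_invariance[OF P T(1) t _ i])
        show "3 - e\<^sup>2 / 2 \<le> x T k \<bullet> x T j" if "j \<in> space \<mu>" for j
          using min_inner_le[OF T(1) k that] T(2) by linarith
      qed
      moreover have "(dist (x T k) (x t i))\<^sup>2 = 6 - 2 * (x T k \<bullet> x t i)"
        using SO3_inner_self[OF cap_SO3[OF P]] SO3_inner_self[OF cap_SO3[OF Q]]
        by (simp add: dist_norm power2_norm_eq_inner inner_diff_left inner_diff_right inner_commute)
      ultimately have "(dist (x T k) (x t i))\<^sup>2 \<le> e\<^sup>2" by (simp add: field_simps)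
      then show ?thesis by (rule power2_le_imp_le) (use e in auto)
    qed
    then show ?thesis using T by blast
  qed
  have "Cauchy (\<lambda>n. x (real n) k)"
  proof (rule metric_CauchyI)
    fix e :: real assume e: "e > 0"
    obtain T where T: "T \<ge> 0" "\<forall>t\<ge>T. \<forall>i\<in>space \<mu>. dist (x T k) (x t i) \<le> e / 3"
      using near[of "e/3"] e by auto
    have "dist (x (real m) k) (x (real n) k) < e" if "m \<ge> nat \<lceil>T\<rceil>" "n \<ge> nat \<lceil>T\<rceil>" for m n
    proof -
      have "real m \<ge> T" "real n \<ge> T" using that by (simp_all add: nat_le_iff ceiling_le_iff)
      then have "dist (x T k) (x (real m) k) \<le> e / 3" "dist (x T k) (x (real n) k) \<le> e / 3"
        using T k by auto
      then show ?thesis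
        using dist_triangle2[of "x (real m) k" "x (real n) k" "x T k"] e by (simp add: dist_commute)
    qed
    then show "\<exists>M. \<forall>m\<ge>M. \<forall>n\<ge>M. dist (x (real m) k) (x (real n) k) < e" by blast
  qed
  then obtain P where P: "(\<lambda>n. x (real n) k) \<longlonglongrightarrow> P"
    using Cauchy_convergent_iff convergent_def by blast
  have I: "mat 1 \<in> cap"
    using eps SO3_inner_self[OF mat1_in_SO3] geo_ball_iff[of "pi/2 - \<epsilon>" "mat 1"] mat1_in_SO3
      cos_monotone_0_pi[of 0 "pi/2 - \<epsilon>"] by simp
  show thesis
  proof (rule that)
    show "P \<in> SO3"
      by (rule closed_sequentially[OF closed_SO3 _ P]) (rule cap_SO3, rule in_cap, simp_all add: k)
    have "c \<le> mat 1 \<bullet> x (real n) k" for n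
      by (rule ball_invariance[OF I, of 0]) (use c k in auto)
    then show "c \<le> mat 1 \<bullet> P"
      by (intro LIMSEQ_le_const[OF tendsto_inner[OF tendsto_const P]]) auto
    fix e :: real assume e: "e > 0"
    obtain T where T: "T \<ge> 0" "\<forall>t\<ge>T. \<forall>i\<in>space \<mu>. dist (x T k) (x t i) \<le> e / 2"
      using near[of "e/2"] e by auto
    have "(\<lambda>n. dist (x T k) (x (real n) k)) \<longlonglongrightarrow> dist (x T k) P"
      by (intro tendsto_dist tendsto_const P)
    moreover have "dist (x T k) (x (real n) k) \<le> e / 2" if "n \<ge> nat \<lceil>T\<rceil>" for n
      using T(2) k that by (simp add: nat_le_iff ceiling_le_iff)
    ultimately have "dist (x T k) P \<le> e / 2" using LIMSEQ_le_const2 by blast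
    then have "dist (x t i) P \<le> e" if "t \<ge> T" "i \<in> space \<mu>" for t i
      using T(2) that dist_triangle3[of "x t i" P "x T k"] by force
    then show "\<exists>T\<ge>0. \<forall>t\<ge>T. \<forall>i\<in>space \<mu>. dist (x t i) P \<le> e" using T(1) by blast
  qed
qed

end

section \<open>Closed balls and Wasserstein distance to a Dirac mass\<close>

lemma tendsto_rotq:
  assumes "(f \<longlongrightarrow> q) F" shows "((\<lambda>n. rotq (f n)) \<longlongrightarrow> rotq q) F"
proof -
  have "\<forall>i j. ((\<lambda>n. rotq (f n) $ i $ j) \<longlongrightarrow> rotq q $ i $ j) F"
    unfolding forall_3 rotq_def Let_def
    by (simp, intro conjI tendsto_add tendsto_diff tendsto_mult tendsto_power tendsto_const tendsto_vec_nth[OF assms])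
  then show ?thesis by (intro vec_tendstoI) blast
qed

text \<open>
  A point on the boundary sphere is approached by adding a small positive real number to its quaternion
  and normalizing, which decreases the angle of rotation.
\<close>

lemma closed_ball_subset_closure:
  assumes r: "0 < r" "r < pi" and P: "P \<in> SO3" "1 + 2 * cos r \<le> mat 1 \<bullet> P"
  shows "P \<in> closure (geo_ball r)"
proof (cases "1 + 2 * cos r < mat 1 \<bullet> P")
  case True
  then have "P \<in> geo_ball r" using P r by (simp add: geo_ball_iff)
  then show ?thesis using closure_subset by blast
next
  case False
  then have tr: "mat 1 \<bullet> P = 1 + 2 * cos r" using P by simp
  have cos: "-1 < cos r" "cos r < 1"
    using cos_monotone_0_pi[of r pi] cos_monotone_0_pi[of 0 r] r by auto
  obtain q where q: "norm q = 1" "q $ 1 > 0" "P = rotq q" using rotq_surj[OF P(1)] tr cos by auto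
  have "mat 1 \<bullet> P = 4 * (q $ 1)\<^sup>2 - 1"
    using inner_rotq_unit[of "axis 1 1" q] q(1) by (simp add: rotq_axis1 inner_axis1 q(3))
  then have "(q $ 1)\<^sup>2 < 1" using tr cos by simp
  define p where "p n = q + (1 / real (Suc n)) *\<^sub>R axis 1 1" for n
  define R where "R n = (1 / (p n \<bullet> p n)) *\<^sub>R rotq (p n)" for n
  have p: "p \<longlonglongrightarrow> q + 0 *\<^sub>R axis 1 1"
    unfolding p_def by (intro tendsto_intros LIMSEQ_Suc[OF lim_1_over_n])
  then have "R \<longlonglongrightarrow> (1 / (q \<bullet> q)) *\<^sub>R rotq q"
    unfolding R_def using q(1) by (intro tendsto_intros tendsto_rotq) (auto simp: norm_eq_1)
  then have "R \<longlonglongrightarrow> P" using q by (simp add: norm_eq_1)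
  moreover have "R n \<in> geo_ball r" for n
  proof -
    define s where "s = 1 / real (Suc n)"
    have s: "s > 0" by (simp add: s_def)
    have p_s: "p n = q + s *\<^sub>R axis 1 1" by (simp only: p_def s_def)
    have ax: "v \<bullet> axis 1 1 = v $ 1" for v :: "real^4" by (simp add: inner_axis)
    have pp: "p n \<bullet> p n = 1 + 2 * s * q $ 1 + s\<^sup>2"
      using q(1) by (simp add: p_s inner_add_left inner_add_right inner_axis1 ax
          norm_eq_1 power2_eq_square algebra_simps)
    have pos: "p n \<bullet> p n > 0" unfolding pp using s q by (intro add_pos_nonneg) auto
    have "mat 1 \<bullet> rotq (p n) = 4 * (q $ 1 + s)\<^sup>2 - p n \<bullet> p n"
      using rotq_inner[of "axis 1 1" "p n"]
      by (simp add: rotq_axis1 inner_axis1) (simp add: p_s)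
    then have "mat 1 \<bullet> R n = 4 * (q $ 1 + s)\<^sup>2 / (p n \<bullet> p n) - 1"
      using pos by (simp add: R_def field_simps)
    moreover have "(q $ 1)\<^sup>2 * (p n \<bullet> p n) < (q $ 1 + s)\<^sup>2"
    proof -
      have "(q $ 1)\<^sup>2 * (2 * s * q $ 1) < 1 * (2 * s * q $ 1)"
        using \<open>(q $ 1)\<^sup>2 < 1\<close> s q by (intro mult_strict_right_mono) auto
      moreover have "(q $ 1)\<^sup>2 * s\<^sup>2 \<le> 1 * s\<^sup>2"
        using \<open>(q $ 1)\<^sup>2 < 1\<close> by (intro mult_right_mono) auto
      ultimately show ?thesis unfolding pp power2_sum distrib_left by (simp add: mult_ac)
    qed
    then have "(q $ 1)\<^sup>2 < (q $ 1 + s)\<^sup>2 / (p n \<bullet> p n)" using pos by (simp add: field_simps)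
    ultimately have "mat 1 \<bullet> R n > 4 * (q $ 1)\<^sup>2 - 1" by simp
    moreover have "R n \<in> SO3" unfolding R_def using pos by (intro rotq_normalized_in_SO3) auto
    ultimately show ?thesis
      using r tr \<open>mat 1 \<bullet> P = 4 * (q $ 1)\<^sup>2 - 1\<close> by (simp add: geo_ball_iff)
  qed
  ultimately show ?thesis unfolding closure_sequential by blast
qed

lemma closure_geo_ball_trace:
  assumes "0 < r" "r < pi" "R \<in> closure (geo_ball r)"
  shows "1 + 2 * cos r \<le> mat 1 \<bullet> R"
proof -
  have "closed {R::mat3. 1 + 2 * cos r \<le> mat 1 \<bullet> R}"
    by (intro closed_Collect_le continuous_intros)
  moreover have "geo_ball r \<subseteq> {R. 1 + 2 * cos r \<le> mat 1 \<bullet> R}"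
    using assms geo_ball_iff[of r] by auto
  ultimately show ?thesis using assms(3) closure_minimal by blast
qed

text \<open>
  The coupling is the image of \<open>\<mu>\<close> under \<open>S \<mapsto> (S, P)\<close>.
\<close>

lemma W1_return_le:
  assumes \<mu>: "\<mu> \<in> prob_measures D" and D: "D \<subseteq> SO3" and P: "P \<in> D"
    and near: "AE S in \<mu>. geo_dist S P \<le> e" and e: "0 \<le> e"
  shows "W1 \<mu> (return (restrict_space borel D) P) \<le> ennreal e"
proof -
  let ?\<nu> = "return (restrict_space borel D) P"
  interpret prob_space \<mu> using \<mu> by (simp add: prob_measures_def)
  have sets: "sets \<mu> = sets (restrict_space borel D)" using \<mu> by (simp add: prob_measures_def)
  have sp: "space \<mu> = D" using sets_eq_imp_space_eq[OF sets] by (simp add: space_restrict_space)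
  have P': "P \<in> space ?\<nu>" using P by (simp add: space_restrict_space)
  define \<pi> where "\<pi> = distr \<mu> (\<mu> \<Otimes>\<^sub>M ?\<nu>) (\<lambda>S. (S, P))"
  have m: "(\<lambda>S. (S, P)) \<in> \<mu> \<rightarrow>\<^sub>M \<mu> \<Otimes>\<^sub>M ?\<nu>" using P' by simp
  have fst: "distr \<pi> \<mu> fst = \<mu>"
    unfolding \<pi>_def by (simp add: distr_distr[OF measurable_fst m] o_def distr_id)
  have "distr \<pi> ?\<nu> snd = distr \<mu> ?\<nu> (\<lambda>_. P)"
    unfolding \<pi>_def by (simp add: distr_distr[OF measurable_snd m] o_def)
  also have "\<dots> = return ?\<nu> P" using P' by (rule distr_const)
  also have "\<dots> = ?\<nu>" by (rule return_cong) simp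
  finally have snd: "distr \<pi> ?\<nu> snd = ?\<nu>" .
  have \<pi>: "\<pi> \<in> couplings \<mu> ?\<nu>"
    unfolding couplings_def using fst snd prob_space_distr[OF m] by (simp add: \<pi>_def)
  have "AE S in distr \<pi> \<mu> fst. geo_dist S P \<le> e" unfolding fst by (rule near)
  then have "AE z in \<pi>. geo_dist (fst z) P \<le> e"
    by (rule AE_distrD[rotated]) (simp only: \<pi>_def measurable_distr_eq1 measurable_fst)
  moreover have "AE z in \<pi>. snd z = P"
  proof (rule AE_distrD[of snd \<pi> ?\<nu>])
    show "AE Q in distr \<pi> ?\<nu> snd. Q = P"
    proof (subst snd, subst AE_return)
      show "Measurable.pred (restrict_space borel D) (\<lambda>Q. Q = P)"
        by (intro measurable_restrict_space1) measurable
    qed (use P' in auto)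
  qed (simp only: \<pi>_def measurable_distr_eq1 measurable_snd)
  ultimately have "AE z in \<pi>. (case z of (R, Q) \<Rightarrow> ennreal (geo_dist R Q)) \<le> ennreal e"
    by eventually_elim (auto simp: split_beta intro: ennreal_leI)
  then have "(\<integral>\<^sup>+ (R, Q). ennreal (geo_dist R Q) \<partial>\<pi>) \<le> (\<integral>\<^sup>+ z. ennreal e \<partial>\<pi>)"
    by (rule nn_integral_mono_AE)
  also have "\<dots> = ennreal e"
    using prob_space.emeasure_space_1[OF prob_space_distr[OF m]] by (simp add: \<pi>_def)
  finally show ?thesis unfolding W1_def using \<pi> by (meson INF_lower2)
qed

lemma tendsto_0_ennrealI:
  fixes f :: "'a \<Rightarrow> ennreal"
  assumes "\<And>e. 0 < e \<Longrightarrow> eventually (\<lambda>t. f t \<le> ennreal e) F"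
  shows "(f \<longlongrightarrow> 0) F"
proof (rule order_tendstoI)
  fix a :: ennreal assume "0 < a"
  then obtain y where y: "0 < y" "y < a" using dense by blast
  then obtain e where e: "y = ennreal e" "0 \<le> e" by (cases y) auto
  then show "eventually (\<lambda>t. f t < a) F"
    using assms[of e] y by (auto elim!: eventually_mono)
qed simp

lemma geo_dist_le_of_dist:
  assumes "R \<in> SO3" "P \<in> SO3" "0 \<le> e" "e \<le> pi" "dist R P \<le> sqrt (4 * (1 - cos e))"
  shows "geo_dist R P \<le> e"
proof -
  have "(dist R P)\<^sup>2 \<le> (sqrt (4 * (1 - cos e)))\<^sup>2" using assms(5) by (intro power_mono) auto
  also have "\<dots> = 4 * (1 - cos e)" by simp
  also have "(dist R P)\<^sup>2 = 6 - 2 * (R \<bullet> P)"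
    using SO3_inner_self[OF assms(1)] SO3_inner_self[OF assms(2)]
    by (simp add: dist_norm power2_norm_eq_inner inner_diff_left inner_diff_right inner_commute)
  finally show ?thesis using geo_dist_le_iff[OF assms(1-4)] by simp
qed

section \<open>Convergence of the aggregation model\<close>

theorem theorem5p10:
  fixes \<epsilon> r :: real
    and K :: "mat3 \<Rightarrow> mat3 \<Rightarrow> real"
    and g g' :: "real \<Rightarrow> real"
    and \<rho>\<^sub>0 :: "mat3 measure"
    and \<rho> :: "real \<Rightarrow> mat3 measure"
  defines "\<D> \<equiv> geo_ball (pi / 2 - \<epsilon>)"
  assumes "\<epsilon> > 0" and "r > 0" and "r < pi / 4 - \<epsilon>"
    and "\<And>R Q. R \<in> SO3 \<Longrightarrow> Q \<in> SO3 \<Longrightarrow> K R Q = g ((geo_dist R Q)\<^sup>2)"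
    and "\<And>s. s \<ge> 0 \<Longrightarrow> (g has_real_derivative g' s) (at s within {0..})"
    and "local_lipschitz (UNIV :: real set) {0..} (\<lambda>_. g')"
    and "\<And>s. s \<ge> 0 \<Longrightarrow> g' s \<ge> 0"
    and "\<exists>g''. continuous_on {0..4 * r\<^sup>2} g'' \<and>
           (\<forall>s\<in>{0..4 * r\<^sup>2}. (g' has_real_derivative g'' s) (at s within {0..4 * r\<^sup>2}))"
    and "\<And>a. a > 0 \<Longrightarrow> \<exists>b. 0 < b \<and> b < a \<and> b < pi \<and> h_fun g' b > 0"
    and "mono_on {0..<pi} (h_fun g')"
    and "\<rho>\<^sub>0 \<in> prob_measures \<D>" and "msupp \<rho>\<^sub>0 \<subseteq> closure (geo_ball r)"
    and "continuous_map (top_of_set {0..}) (narrow_topology \<D>) \<rho>"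
    and "global_weak_solution \<D> K \<rho>\<^sub>0 \<rho>"
  shows "\<exists>P\<in>closure (geo_ball r).
           ((\<lambda>t. W1 (\<rho> t) (return (restrict_space borel \<D>) P)) \<longlongrightarrow> 0) at_top"
proof -
  note eps = assms(2) and r = assms(3,4) and K = assms(5) and g = assms(6) and g'_nonneg = assms(8)
    and h_small = assms(10) and h_mono = assms(11) and supp = assms(13)
  have eps': "\<epsilon> < pi / 2" and r': "r < pi / 2 - \<epsilon>" "r < pi" using eps r by linarith+
  have D_SO3: "\<D> \<subseteq> SO3" by (auto simp: \<D>_def geo_ball_def)
  let ?h = "h_fun g'" and ?\<mu> = "restrict_space \<rho>\<^sub>0 (msupp \<rho>\<^sub>0)"
  obtain \<Psi> where \<Psi>: "is_flow_map (velocity K \<rho>) (msupp \<rho>\<^sub>0) \<D> \<Psi>"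
    and meas: "\<And>t. t \<ge> 0 \<Longrightarrow> \<Psi> t \<in> ?\<mu> \<rightarrow>\<^sub>M restrict_space borel \<D>"
    and push: "\<And>t. t \<ge> 0 \<Longrightarrow> \<rho> t = distr ?\<mu> (restrict_space borel \<D>) (\<Psi> t)"
    and prob: "\<And>t. t \<ge> 0 \<Longrightarrow> \<rho> t \<in> prob_measures \<D>"
    using assms(15) unfolding global_weak_solution_def by blast
  have space_\<mu>: "space ?\<mu> = msupp \<rho>\<^sub>0" by (auto simp: space_restrict_space msupp_def)
  have \<Psi>0: "\<Psi> 0 R = R" if "R \<in> msupp \<rho>\<^sub>0" for R using \<Psi> that by (simp add: is_flow_map_def)
  have \<Psi>_D: "\<Psi> t R \<in> \<D>" if "t \<ge> 0" "R \<in> msupp \<rho>\<^sub>0" for t R using \<Psi> that by (simp add: is_flow_map_def)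
  have \<Psi>': "((\<lambda>\<tau>. \<Psi> \<tau> R) has_vector_derivative velocity K \<rho> (\<Psi> t R) t) (at t within {0..})"
    if "t \<ge> 0" "R \<in> msupp \<rho>\<^sub>0" for t R using \<Psi> that by (simp add: is_flow_map_def)
  have "prob_space (distr ?\<mu> (restrict_space borel \<D>) (\<Psi> 0))"
    using prob[of 0] push[of 0] by (simp add: prob_measures_def)
  \<comment> \<open>The labels are the points of the support of \<open>\<rho>\<^sub>0\<close>. The support has full measure because the
      push-forward is a probability measure.\<close>
  then interpret M: prob_space ?\<mu> by (rule prob_space_distrD[OF meas[OF order_refl]])
  have h_pos: "?h s > 0" if s: "0 < s" "s < pi" for s
  proof -
    obtain b where "0 < b" "b < s" "b < pi" "?h b > 0" using h_small[OF s(1)] by blast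
    moreover have "?h b \<le> ?h s" using calculation s by (intro mono_onD[OF h_mono]) auto
    ultimately show ?thesis by linarith
  qed
  have h0: "?h 0 \<ge> 0" using g'_nonneg[of 0] by (simp add: h_fun_def)
  have geo_lt: "geo_dist R Q < pi" "R \<bullet> Q > -1" if RQ: "R \<in> \<D>" "Q \<in> \<D>" for R Q
  proof -
    have RQ': "R \<in> geo_ball (pi/2 - \<epsilon>)" "Q \<in> geo_ball (pi/2 - \<epsilon>)" using RQ by (simp_all add: \<D>_def)
    show "geo_dist R Q < pi" using geo_ball_geo_dist(2)[OF eps eps' RQ'] eps by simp
    show "R \<bullet> Q > -1" using geo_ball_coordinates(1,4)[OF eps eps' RQ'] by simp
  qed
  have F_meas: "(\<lambda>Q. ?h (geo_dist R Q) *\<^sub>R drift R Q) \<in> borel_measurable (restrict_space borel \<D>)"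
    if "R \<in> \<D>" for R
    using that D_SO3 geo_lt(1)[OF that] by (intro interaction_measurable h_mono) auto
  have vel: "velocity K \<rho> R t = (LINT j|?\<mu>. ?h (geo_dist R (\<Psi> t j)) *\<^sub>R drift R (\<Psi> t j))"
    if t: "t \<ge> 0" and R: "R \<in> \<D>" for R t
  proof -
    have "space (\<rho> t) = \<D>" using push[OF t] by (simp add: space_restrict_space)
    then have "velocity K \<rho> R t = - (LINT Q|\<rho> t. - (?h (geo_dist R Q) *\<^sub>R drift R Q))"
      unfolding velocity_def using R D_SO3 geo_lt(2)[OF R] K g
      by (intro arg_cong[where f = uminus] Bochner_Integration.integral_cong refl grad_kernel) auto
    also have "\<dots> = (LINT Q|\<rho> t. ?h (geo_dist R Q) *\<^sub>R drift R Q)" by simp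
    also have "\<dots> = (LINT j|?\<mu>. ?h (geo_dist R (\<Psi> t j)) *\<^sub>R drift R (\<Psi> t j))"
      unfolding push[OF t] by (rule integral_distr[OF meas[OF t] F_meas[OF R]])
    finally show ?thesis .
  qed
  interpret aggregation_flow ?\<mu> \<epsilon> ?h \<Psi>
  proof unfold_locales
    fix t :: real assume t: "0 \<le> t"
    show "\<Psi> t \<in> borel_measurable ?\<mu>" using meas[OF t] by (simp add: measurable_restrict_space2_iff)
  next
    fix t i assume t: "(0::real) \<le> t" and i: "i \<in> space ?\<mu>"
    show "\<Psi> t i \<in> geo_ball (pi / 2 - \<epsilon>)" using \<Psi>_D[OF t] i by (simp add: space_\<mu> \<D>_def)
    show "((\<lambda>\<tau>. \<Psi> \<tau> i) has_vector_derivative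
        (LINT j|?\<mu>. ?h (geo_dist (\<Psi> t i) (\<Psi> t j)) *\<^sub>R drift (\<Psi> t i) (\<Psi> t j))) (at t within {0..})"
      using \<Psi>'[OF t] \<Psi>_D[OF t] vel[OF t] i by (simp add: space_\<mu>)
  qed (use eps eps' h_mono h0 h_pos in auto)
  have init: "1 + 2 * cos r \<le> mat 1 \<bullet> \<Psi> 0 i" if "i \<in> space ?\<mu>" for i
    using that supp closure_geo_ball_trace[OF r(1) r'(2)] by (auto simp: space_\<mu> \<Psi>0)
  obtain P where P: "P \<in> SO3" "1 + 2 * cos r \<le> mat 1 \<bullet> P"
    and conv: "\<And>e. e > 0 \<Longrightarrow> \<exists>T\<ge>0. \<forall>t\<ge>T. \<forall>i\<in>space ?\<mu>. dist (\<Psi> t i) P \<le> e"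
    using consensus[OF init] by blast
  have "cos (pi / 2 - \<epsilon>) < cos r" using r r' eps by (intro cos_monotone_0_pi) auto
  then have P_D: "P \<in> \<D>" unfolding \<D>_def using P eps eps' by (subst geo_ball_iff) auto
  show ?thesis
  proof (intro bexI tendsto_0_ennrealI)
    show "P \<in> closure (geo_ball r)" using closed_ball_subset_closure[OF r(1) r'(2) P] .
    fix e :: real assume e: "e > 0"
    \<comment> \<open>The threshold \<open>sqrt (4 * (1 - cos e'))\<close> is the Frobenius distance of rotations at geodesic
        distance \<open>e'\<close>.\<close>
    define e' where "e' = min e 1"
    have e': "0 < e'" "e' < pi" "e' \<le> e" using e pi_gt3 by (auto simp: e'_def)
    have "cos e' < cos 0" using e' by (intro cos_monotone_0_pi) auto
    then have "sqrt (4 * (1 - cos e')) > 0" by simp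
    then obtain T where T: "T \<ge> 0" "\<And>t i. t \<ge> T \<Longrightarrow> i \<in> space ?\<mu> \<Longrightarrow> dist (\<Psi> t i) P \<le> sqrt (4 * (1 - cos e'))"
      using conv by blast
    have "W1 (\<rho> t) (return (restrict_space borel \<D>) P) \<le> ennreal e" if "t \<ge> T" for t
    proof -
      have t: "t \<ge> 0" using that T by simp
      have "(\<lambda>S. geo_dist S P) \<in> borel_measurable (restrict_space borel \<D>)"
        using continuous_on_geo_dist[OF P(1) D_SO3]
        by (intro borel_measurable_continuous_on_restrict) (simp add: geo_dist_inner[abs_def] inner_commute)
      then have "{S \<in> space (restrict_space borel \<D>). geo_dist S P \<le> e'} \<in> sets (restrict_space borel \<D>)"
        by measurable
      then have "AE S in \<rho> t. geo_dist S P \<le> e'"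
        unfolding push[OF t]
      proof (subst AE_distr_iff[OF meas[OF t]])
        show "AE i in ?\<mu>. geo_dist (\<Psi> t i) P \<le> e'"
          using T(2)[OF that] \<Psi>_D[OF t] D_SO3 P e'
          by (intro AE_I2 geo_dist_le_of_dist) (auto simp: space_\<mu>)
      qed
      then have "W1 (\<rho> t) (return (restrict_space borel \<D>) P) \<le> ennreal e'"
        using e' by (intro W1_return_le[OF prob[OF t] D_SO3 P_D]) auto
      also have "\<dots> \<le> ennreal e" using e' by (intro ennreal_leI)
      finally show ?thesis .
    qed
    then show "\<forall>\<^sub>F t in at_top. W1 (\<rho> t) (return (restrict_space borel \<D>) P) \<le> ennreal e"
      unfolding eventually_at_top_linorder by blast
  qed
qed

end
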